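(* Let $K$ be a field of characteristic $0$ and let $R$ be a proper retract of the free associative algebra $K\langle x,y\rangle$. Then there is a $K$-algebra automorphism $\psi$ of $K\langle x,y\rangle$ that takes $R$ to $K\langle v\rangle = K[v]$ for some element $v \in K\langle x,y\rangle$ of the form $v = x + y\cdot q(x,y) + w(x,y)$, where $q(x,y)\in K\langle x,y\rangle$ and $w(x,y)$ belongs to the commutator ideal of $K\langle x,y\rangle$.
   Context: $K\langle x,y\rangle$ is the free associative unital $K$-algebra on $x,y$. A $K$-subalgebra $R$ of $K\langle x,y\rangle$ is called a retract if there is an idempotent $K$-algebra endomorphism $\varphi$ of $K\langle x,y\rangle$ with $\varphi(K\langle x,y\rangle)=R$; it is proper if it is different from $K$ and from $K\langle x,y\rangle$. The commutator ideal of $K\langle x,y\rangle$ is the two-sided ideal generated by all commutators $ab-ba$, i.e. the kernel of the natural abelianization map $K\langle x,y\rangle\to K[x,y]$. $K\langle v\rangle = K[v]$ is the $K$-subalgebra generated by $v$. *)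

theory Defs
  imports Complex_Main "HOL-Library.Poly_Mapping"
begin

datatype letter = X | Y

datatype word = Word (letters: "letter list")

text \<open>Words form the free monoid, written additively (the sum is concatenation, \<open>0\<close> is the empty
  word), because the convolution product of \<^typ>\<open>'a \<Rightarrow>\<^sub>0 'b\<close> is defined over an additive monoid of
  exponents.\<close>

instantiation word :: monoid_add
begin

definition zero_word :: word where
  "0 = Word []"

definition plus_word :: "word \<Rightarrow> word \<Rightarrow> word" where
  "u + v = Word (letters u @ letters v)"

instance
  by standard (simp_all add: zero_word_def plus_word_def)

end

text \<open>The free associative algebra \<open>K\<langle>x,y\<rangle>\<close>, i.e. the monoid algebra of the free monoid of words;
  its ring structure is the one of \<^theory>\<open>HOL-Library.Poly_Mapping\<close>.\<close>

type_synonym 'k free_alg = "word \<Rightarrow>\<^sub>0 'k"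

definition const :: "'k \<Rightarrow> 'k::field free_alg" where
  "const c = Poly_Mapping.single 0 c"

definition var_x :: "'k::field free_alg" where
  "var_x = Poly_Mapping.single (Word [X]) 1"

definition var_y :: "'k::field free_alg" where
  "var_y = Poly_Mapping.single (Word [Y]) 1"

definition scale :: "'k \<Rightarrow> 'k free_alg \<Rightarrow> 'k::field free_alg" where
  "scale c f = const c * f"

definition alg_endo :: "('k::field free_alg \<Rightarrow> 'k free_alg) \<Rightarrow> bool" where
  "alg_endo \<phi> \<longleftrightarrow>
     \<phi> 1 = 1 \<and>
     (\<forall>f g. \<phi> (f + g) = \<phi> f + \<phi> g) \<and>
     (\<forall>f g. \<phi> (f * g) = \<phi> f * \<phi> g) \<and>
     (\<forall>c f. \<phi> (scale c f) = scale c (\<phi> f))"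

definition alg_auto :: "('k::field free_alg \<Rightarrow> 'k free_alg) \<Rightarrow> bool" where
  "alg_auto \<psi> \<longleftrightarrow> alg_endo \<psi> \<and> bij \<psi>"

definition subalgebra :: "'k::field free_alg set \<Rightarrow> bool" where
  "subalgebra S \<longleftrightarrow>
     1 \<in> S \<and>
     (\<forall>f\<in>S. \<forall>g\<in>S. f + g \<in> S) \<and>
     (\<forall>f\<in>S. \<forall>g\<in>S. f * g \<in> S) \<and>
     (\<forall>c. \<forall>f\<in>S. scale c f \<in> S)"

text \<open>\<open>K\<langle>v\<rangle>\<close>, also written \<open>K[v]\<close>.\<close>

definition gen_subalgebra :: "'k::field free_alg \<Rightarrow> 'k free_alg set" where
  "gen_subalgebra v = subalgebra hull {v}"

definition retract :: "'k::field free_alg set \<Rightarrow> bool" where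
  "retract R \<longleftrightarrow> subalgebra R \<and> (\<exists>\<phi>. alg_endo \<phi> \<and> \<phi> \<circ> \<phi> = \<phi> \<and> \<phi> ` UNIV = R)"

definition proper_retract :: "'k::field free_alg set \<Rightarrow> bool" where
  "proper_retract R \<longleftrightarrow> retract R \<and> R \<noteq> const ` UNIV \<and> R \<noteq> UNIV"

definition two_sided_ideal :: "'k::field free_alg set \<Rightarrow> bool" where
  "two_sided_ideal I \<longleftrightarrow>
     0 \<in> I \<and>
     (\<forall>f\<in>I. \<forall>g\<in>I. f + g \<in> I) \<and>
     (\<forall>h. \<forall>f\<in>I. h * f \<in> I \<and> f * h \<in> I)"

definition commutator_ideal :: "'k::field free_alg set" where
  "commutator_ideal = two_sided_ideal hull {a * b - b * a |a b. True}"

end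

theory Submission
  imports Defs "Jordan_Normal_Form.Char_Poly" "HOL-Computational_Algebra.Formal_Laurent_Series"
    "HOL-Computational_Algebra.Polynomial_Factorial"
begin

text \<open>Let \<open>\<phi>\<close> be an idempotent endomorphism with image \<open>R\<close>. After a translation \<open>\<phi>\<close> preserves the
  augmentation ideal, so its linear part is an idempotent \<open>2 \<times> 2\<close> matrix. Comparing lowest forms shows
  that \<open>\<phi>\<close> is the identity if this matrix is invertible, and that otherwise \<open>R\<close> embeds in \<open>K[t]\<close> by
  restriction to a line through the origin. Composing with \<open>\<phi>\<close> we get \<open>\<theta>: K\<langle>x,y\<rangle> \<rightarrow> K[t]\<close> with the same
  kernel as \<open>\<phi>\<close>, i.e. a polynomial plane curve \<open>(u, v)\<close>. The retraction makes this curve smooth, which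
  means that \<open>f\<^sub>Y(u, v)\<close> divides \<open>u'\<close> for its equation \<open>f\<close>. As in the theorem of Abhyankar and Moh,
  this forces one of \<open>deg u\<close>, \<open>deg v\<close> to divide the other: a tower of key polynomials over \<open>K(u)\<close>
  inside \<open>K((1/t))\<close> bounds the degree of \<open>f\<^sub>Y(u, v)\<close> from below, where characteristic 0 enters through
  Tschirnhausen transformations that make the key polynomials integral over \<open>K[u]\<close>. Hence elementary
  automorphisms reduce the curve to \<open>v = 0\<close>. Then \<open>\<phi> y = 0\<close>, so that \<open>R\<close> is generated by \<open>\<phi> x\<close>, and
  \<open>\<theta> (\<phi> x) = \<theta> x\<close> says that \<open>\<phi> x\<close> is \<open>x\<close> modulo \<open>y\<close> and commutators.\<close>

text \<open>The homomorphism \<theta> need not be onto \<open>K[t]\<close>, so \<open>(u, v)\<close>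
  need not be an embedded line and the theorem on such lines does not apply as it stands; smoothness
  takes the place of the embedding. The contradiction is numerical. Let \<open>n = deg u\<close> and
  \<open>m = deg v\<close>. Smoothness bounds the degree of \<open>f\<^sub>Y(u, v)\<close> above by
  \<open>deg u' = n - 1\<close>. Divided by \<open>deg f\<close>, the polynomial
  \<open>f\<^sub>Y\<close> is monic of degree \<open>deg f - 1\<close> in Y, and if n does not
  divide m, its value has degree at least \<open>(n / gcd n m - 1) * m\<close>. Both bounds together
  force m to divide n. This lower bound is the contribution of the first key polynomial, Y itself. A
  later key polynomial g adds \<open>(q - 1) * deg g(u, v)\<close> with \<open>q > 0\<close>. Over
  \<open>K(u)\<close> that could a priori be negative, but the value of a polynomial over
  \<open>K[u]\<close> is a polynomial in t: this is why integral key polynomials are constructed.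
  The key polynomials themselves come from a dimension count instead of Puiseux expansions.\<close>

hide_const (open) Module.smult

section \<open>Key polynomials over a subfield of a valued field\<close>

lemma degree_diff_lead_less:
  fixes p q :: "'b::ab_group_add poly"
  assumes "degree p \<le> n" "degree q \<le> n" "coeff p n = coeff q n" "n > 0"
  shows "degree (p - q) < n"
proof -
  have "degree (p - q) \<le> n - 1"
  proof (rule degree_le, safe)
    fix i assume "n - 1 < i"
    then consider "i = n" | "i > n" by linarith
    then show "coeff (p - q) i = 0"
      using assms coeff_eq_0[of p i] coeff_eq_0[of q i] by cases auto
  qed
  then show ?thesis using assms(4) by linarith
qed

text \<open>Only binomial terms with at least two factors \<open>y\<close> remain, and
  \<open>s \<le> N\<close> makes the bound for exactly two factors the largest. It controls the
  error when a correction \<open>y\<close> of a polynomial \<open>x\<close> is designed by its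
  linear effect on \<open>x ^ d\<close>.\<close>

lemma power_add_linear_degree:
  fixes x y :: "'b::comm_ring_1 poly"
  assumes "degree x \<le> N" "degree y \<le> s" "s \<le> N" "d \<ge> 2"
  shows "degree ((x + y) ^ d - x ^ d - of_nat d * y * x ^ (d - 1)) \<le> 2 * s + (d - 2) * N"
proof -
  define t where "t = (\<lambda>j. of_nat (d choose j) * y ^ j * x ^ (d - j))"
  have "(x + y) ^ d = (\<Sum>j\<le>d. t j)"
    using binomial_ring[of y x d] by (simp add: t_def add.commute)
  also have "\<dots> = (\<Sum>j\<in>{0,1} \<union> {2..d}. t j)"
    using assms(4) by (intro sum.cong) auto
  also have "\<dots> = t 0 + t 1 + (\<Sum>j=2..d. t j)"
    by (subst sum.union_disjoint) auto
  finally have "(x + y) ^ d - x ^ d - of_nat d * y * x ^ (d - 1) = (\<Sum>j=2..d. t j)"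
    by (simp add: t_def)
  moreover have "degree (t j) \<le> 2 * s + (d - 2) * N" if j: "j \<in> {2..d}" for j
  proof -
    have "degree (t j) \<le> degree (of_nat (d choose j) * y ^ j) + degree (x ^ (d - j))"
      unfolding t_def by (rule degree_mult_le)
    also have "degree (of_nat (d choose j) * y ^ j) \<le> degree (y ^ j)"
      using degree_mult_le[of "of_nat (d choose j)" "y ^ j"] by simp
    also have "degree (y ^ j) \<le> j * s"
      using degree_power_le[of y j] assms(2) by (metis mult.commute mult_le_mono2 order_trans)
    also have "degree (x ^ (d - j)) \<le> (d - j) * N"
      using degree_power_le[of x "d - j"] assms(1) by (metis mult.commute mult_le_mono2 order_trans)
    also have "j * s + (d - j) * N \<le> 2 * s + (d - 2) * N"
    proof -
      obtain i where i: "j = 2 + i" using j by (auto simp: le_iff_add)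
      obtain e where e: "d = j + e" using j by (auto simp: le_iff_add)
      show ?thesis using assms(3) by (simp add: i e algebra_simps)
    qed
    finally show ?thesis by simp
  qed
  ultimately show ?thesis by (metis degree_sum_le finite_atLeastAtMost)
qed

text \<open>\<open>dg\<close> is a degree, i.e. minus a valuation; its value at 0 carries no information.\<close>

locale valued_field =
  fixes dg :: "'l::field \<Rightarrow> int" and F :: "'l set"
  assumes dg_mult: "\<lbrakk>a \<noteq> 0; b \<noteq> 0\<rbrakk> \<Longrightarrow> dg (a * b) = dg a + dg b"
    and dg_add: "\<lbrakk>a \<noteq> 0; b \<noteq> 0; a + b \<noteq> 0\<rbrakk> \<Longrightarrow> dg (a + b) \<le> max (dg a) (dg b)"
    and F_0: "0 \<in> F" and F_1: "1 \<in> F"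
    and F_add: "\<lbrakk>a \<in> F; b \<in> F\<rbrakk> \<Longrightarrow> a + b \<in> F"
    and F_uminus: "a \<in> F \<Longrightarrow> - a \<in> F"
    and F_mult: "\<lbrakk>a \<in> F; b \<in> F\<rbrakk> \<Longrightarrow> a * b \<in> F"
    and F_inverse: "a \<in> F \<Longrightarrow> inverse a \<in> F"
begin

section \<open>Ultrametric calculus of degrees\<close>

lemma dg_1 [simp]: "dg 1 = 0"
  using dg_mult[of 1 1] by simp

lemma dg_uminus [simp]: "dg (- a) = dg a"
proof (cases "a = 0")
  case False
  have "dg (-1) = 0" using dg_mult[of "-1" "-1"] by simp
  then show ?thesis using dg_mult[of "-1" a] False by simp
qed simp

lemma dg_power: "a \<noteq> 0 \<Longrightarrow> dg (a ^ k) = int k * dg a"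
  by (induction k) (auto simp: dg_mult algebra_simps)

lemma dg_add_less:
  assumes "a \<noteq> 0" "b \<noteq> 0" "dg a < dg b"
  shows "a + b \<noteq> 0" "dg (a + b) = dg b"
proof -
  show ne: "a + b \<noteq> 0"
  proof
    assume "a + b = 0"
    then have "b = - a" by (simp add: eq_neg_iff_add_eq_0 add.commute)
    then show False using assms(3) by simp
  qed
  have "dg (a + b) \<le> dg b" using dg_add[OF assms(1,2) ne] assms(3) by simp
  moreover have "dg b \<le> max (dg (a + b)) (dg a)"
    using dg_add[of "a + b" "- a"] assms ne by simp
  ultimately show "dg (a + b) = dg b" using assms(3) by simp
qed

definition dg_le :: "'l \<Rightarrow> int \<Rightarrow> bool" where
  "dg_le a C \<longleftrightarrow> a = 0 \<or> dg a \<le> C"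

lemma dg_le_0 [simp]: "dg_le 0 C" by (simp add: dg_le_def)

lemma dg_le_mono: "dg_le a C \<Longrightarrow> C \<le> C' \<Longrightarrow> dg_le a C'" by (auto simp: dg_le_def)

lemma dg_le_add: "dg_le a C \<Longrightarrow> dg_le b C \<Longrightarrow> dg_le (a + b) C"
  using dg_add[of a b] by (cases "a = 0"; cases "b = 0"; cases "a + b = 0") (auto simp: dg_le_def)

lemma dg_le_uminus [simp]: "dg_le (- a) C \<longleftrightarrow> dg_le a C" by (simp add: dg_le_def)

lemma dg_le_mult: "dg_le a C \<Longrightarrow> dg_le b C' \<Longrightarrow> dg_le (a * b) (C + C')"
  by (cases "a = 0"; cases "b = 0") (auto simp: dg_le_def dg_mult)

lemma dg_le_add_distinct:
  assumes "a \<noteq> 0 \<Longrightarrow> b \<noteq> 0 \<Longrightarrow> dg a \<noteq> dg b" "dg_le (a + b) C"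
  shows "dg_le a C" "dg_le b C"
proof -
  have "dg_le a C \<and> dg_le b C"
  proof (cases "a = 0 \<or> b = 0")
    case False
    then consider "dg a < dg b" | "dg b < dg a" using assms(1) by force
    then show ?thesis
    proof cases
      case 1 then show ?thesis using False dg_add_less[of a b] assms(2) by (auto simp: dg_le_def)
    next
      case 2 then show ?thesis using False dg_add_less[of b a] assms(2)
        by (auto simp: dg_le_def add.commute)
    qed
  qed (use assms in auto)
  then show "dg_le a C" "dg_le b C" by auto
qed

text \<open>Distinct degrees exclude cancellation, so the largest one survives. That it is attained
  by a summand will give divisibility of the degree; that it bounds all summands will give bounds on
  digits.\<close>

lemma sum_distinct:
  assumes "finite I" "\<And>i j. \<lbrakk>i \<in> I; j \<in> I; i \<noteq> j; z i \<noteq> 0; z j \<noteq> 0\<rbrakk> \<Longrightarrow> dg (z i) \<noteq> dg (z j)"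
    "\<exists>i\<in>I. z i \<noteq> 0"
  shows "sum z I \<noteq> 0 \<and> (\<exists>i\<in>I. z i \<noteq> 0 \<and> dg (sum z I) = dg (z i)) \<and>
         (\<forall>i\<in>I. z i \<noteq> 0 \<longrightarrow> dg (z i) \<le> dg (sum z I))"
  using assms
proof (induction I rule: finite_induct)
  case empty then show ?case by simp
next
  case (insert i I)
  consider "z i = 0" | "z i \<noteq> 0" "\<forall>j\<in>I. z j = 0" | "z i \<noteq> 0" "\<exists>j\<in>I. z j \<noteq> 0" by auto
  then show ?case
  proof cases
    case 1
    then have "\<exists>i\<in>I. z i \<noteq> 0" using insert.prems(2) by auto
    then have "sum z I \<noteq> 0 \<and> (\<exists>i\<in>I. z i \<noteq> 0 \<and> dg (sum z I) = dg (z i)) \<and>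
         (\<forall>i\<in>I. z i \<noteq> 0 \<longrightarrow> dg (z i) \<le> dg (sum z I))"
      by (intro insert.IH) (simp_all add: insert.prems(1))
    then show ?thesis using 1 insert.hyps by simp
  next
    case 2
    then have "sum z I = 0" by simp
    then show ?thesis using insert.hyps 2 by simp
  next
    case 3
    have "sum z I \<noteq> 0 \<and> (\<exists>i\<in>I. z i \<noteq> 0 \<and> dg (sum z I) = dg (z i)) \<and>
         (\<forall>i\<in>I. z i \<noteq> 0 \<longrightarrow> dg (z i) \<le> dg (sum z I))"
      by (intro insert.IH 3(2)) (simp_all add: insert.prems(1))
    then have IH: "sum z I \<noteq> 0" "\<forall>j\<in>I. z j \<noteq> 0 \<longrightarrow> dg (z j) \<le> dg (sum z I)"
      and "\<exists>j\<in>I. z j \<noteq> 0 \<and> dg (sum z I) = dg (z j)" by auto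
    then obtain j where j: "j \<in> I" "z j \<noteq> 0" "dg (sum z I) = dg (z j)" by auto
    have ne: "dg (z i) \<noteq> dg (sum z I)"
      using insert.prems(1)[of i j] j 3(1) insert.hyps by auto
    show ?thesis
    proof (cases "dg (z i) < dg (sum z I)")
      case True
      then show ?thesis using dg_add_less[OF 3(1) IH(1) True] insert.hyps IH(2) j by auto
    next
      case False
      then have "dg (sum z I) < dg (z i)" using ne by simp
      from dg_add_less[OF IH(1) 3(1) this] this show ?thesis using insert.hyps IH(2) 3(1)
        by (auto simp: add.commute intro: order_trans less_imp_le)
    qed
  qed
qed

section \<open>Polynomials over the subfield and their g-adic expansions\<close>

definition polyF :: "'l poly set" where "polyF = {p. \<forall>i. coeff p i \<in> F}"

lemma F_sum: "(\<And>i. i \<in> I \<Longrightarrow> a i \<in> F) \<Longrightarrow> sum a I \<in> F"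
  by (induction I rule: infinite_finite_induct) (auto intro: F_0 F_add)

lemma polyF_0: "0 \<in> polyF" by (simp add: polyF_def F_0)
lemma polyF_const: "c \<in> F \<Longrightarrow> [:c:] \<in> polyF"
  by (simp add: polyF_def coeff_pCons F_0 split: nat.split)
lemma polyF_1: "1 \<in> polyF" using polyF_const[OF F_1] by (simp add: one_pCons)
lemma polyF_add: "p \<in> polyF \<Longrightarrow> q \<in> polyF \<Longrightarrow> p + q \<in> polyF" by (simp add: polyF_def F_add)
lemma polyF_uminus: "p \<in> polyF \<Longrightarrow> - p \<in> polyF" by (simp add: polyF_def F_uminus)
lemma polyF_diff: "p \<in> polyF \<Longrightarrow> q \<in> polyF \<Longrightarrow> p - q \<in> polyF"
  using polyF_add[of p "- q"] polyF_uminus[of q] by simp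
lemma polyF_mult: "p \<in> polyF \<Longrightarrow> q \<in> polyF \<Longrightarrow> p * q \<in> polyF"
  by (simp add: polyF_def coeff_mult F_sum F_mult)
lemma polyF_power: "p \<in> polyF \<Longrightarrow> p ^ k \<in> polyF" by (induction k) (auto intro: polyF_1 polyF_mult)
lemma polyF_smult: "c \<in> F \<Longrightarrow> p \<in> polyF \<Longrightarrow> smult c p \<in> polyF" by (simp add: polyF_def F_mult)
lemma polyF_monom: "c \<in> F \<Longrightarrow> monom c k \<in> polyF" by (simp add: polyF_def F_0)
lemma polyF_divide_monic:
  assumes "g \<in> polyF" "lead_coeff g = 1" "degree g = N" "N > 0" "p \<in> polyF"
  shows "\<exists>a\<in>polyF. \<exists>b\<in>polyF. p = a * g + b \<and> degree b < N \<and> (a \<noteq> 0 \<longrightarrow> degree a + N = degree p)"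
  using assms(5)
proof (induction "degree p" arbitrary: p rule: less_induct)
  case less
  show ?case
  proof (cases "degree p < N")
    case True
    then show ?thesis using less.prems polyF_0 by (intro bexI[of _ 0] bexI[of _ p]) auto
  next
    case False
    let ?m = "monom (lead_coeff p) (degree p - N)"
    let ?r = "p - ?m * g"
    have p0: "p \<noteq> 0" using False assms(4) by auto
    have m: "?m \<in> polyF" using less.prems by (intro polyF_monom) (simp add: polyF_def)
    have g0: "g \<noteq> 0" using assms by auto
    have m0: "?m \<noteq> 0" using p0 by simp
    have dm: "degree ?m = degree p - N" using p0 by (simp add: degree_monom_eq)
    have "degree (?m * g) = degree p" using False dm assms(3) g0 m0 by (simp add: degree_mult_eq)
    moreover have "lead_coeff (?m * g) = lead_coeff p"
      using assms(2) by (simp only: lead_coeff_mult lead_coeff_monom mult_1_right)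
    ultimately have "degree ?r < degree p"
      using False assms(4) by (intro degree_diff_lead_less) auto
    moreover have "?r \<in> polyF" using less.prems m assms(1) by (intro polyF_diff polyF_mult)
    ultimately obtain a b where ab: "a \<in> polyF" "b \<in> polyF" "?r = a * g + b" "degree b < N"
      "a \<noteq> 0 \<longrightarrow> degree a + N = degree ?r"
      using less.hyps by blast
    have "p = (?m + a) * g + b" using ab(3) by (simp add: algebra_simps)
    moreover have "degree (?m + a) = degree p - N"
    proof (cases "a = 0")
      case False
      then have "degree a < degree ?m" using ab(5) \<open>degree ?r < degree p\<close> dm by simp
      then show ?thesis using dm by (simp add: degree_add_eq_left)
    qed (use dm in simp)
    ultimately show ?thesis using ab(1,2,4) m False
      by (intro bexI[of _ "?m + a"] bexI[of _ b]) (auto intro: polyF_add)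
  qed
qed

lemma polyF_expand:
  assumes "g \<in> polyF" "lead_coeff g = 1" "degree g = N" "N > 0" "p \<in> polyF" "degree p < K * N"
  shows "\<exists>b. (\<forall>k. b k \<in> polyF \<and> degree (b k) < N) \<and> p = (\<Sum>k<K. b k * g ^ k)"
  using assms(5,6)
proof (induction K arbitrary: p)
  case 0 then show ?case by simp
next
  case (Suc K)
  obtain a b where ab: "a \<in> polyF" "b \<in> polyF" "p = a * g + b" "degree b < N"
      "a \<noteq> 0 \<longrightarrow> degree a + N = degree p"
    using polyF_divide_monic[OF assms(1-4) Suc.prems(1)] by blast
  show ?case
  proof (cases "a = 0")
    case True
    have "p = (\<Sum>k<Suc K. (if k = 0 then b else 0) * g ^ k)"
      using True ab(3) by (simp add: sum.lessThan_Suc_shift del: sum.lessThan_Suc)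
    then show ?thesis using ab assms(4) polyF_0
      by (intro exI[of _ "\<lambda>k. if k = 0 then b else 0"]) auto
  next
    case False
    then have "degree a < K * N" using ab(5) Suc.prems(2) by simp
    from Suc.IH[OF ab(1) this] obtain c where c: "\<And>k. c k \<in> polyF \<and> degree (c k) < N"
      "a = (\<Sum>k<K. c k * g ^ k)" by blast
    have "p = (\<Sum>k<Suc K. (case k of 0 \<Rightarrow> b | Suc j \<Rightarrow> c j) * g ^ k)"
      unfolding ab(3) c(2)
      by (subst sum.lessThan_Suc_shift) (simp add: sum_distrib_right mult.assoc power_commutes)
    then show ?thesis using ab c
      by (intro exI[of _ "\<lambda>k. case k of 0 \<Rightarrow> b | Suc j \<Rightarrow> c j"]) (auto split: nat.split)
  qed
qed

lemma degree_expansion_less: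
  fixes b :: "nat \<Rightarrow> 'l poly"
  assumes "degree g = N" "\<And>k. degree (b k) < N" "K > 0"
  shows "degree (\<Sum>k<K. b k * g ^ k) < K * N"
proof -
  have "degree (b k * g ^ k) \<le> K * N - 1" if "k < K" for k
  proof -
    have "degree (b k * g ^ k) \<le> degree (b k) + k * N"
      using degree_mult_le[of "b k" "g ^ k"] degree_power_le[of g k] assms(1)
      by (simp add: mult.commute)
    also have "\<dots> < Suc k * N" using assms(2)[of k] by simp
    also have "\<dots> \<le> K * N" using that by (intro mult_right_mono) auto
    finally show ?thesis by simp
  qed
  then have "degree (\<Sum>k<K. b k * g ^ k) \<le> K * N - 1"
    by (intro degree_sum_le) auto
  moreover have "K * N > 0" using assms(2)[of 0] assms(3) by simp
  ultimately show ?thesis by linarith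
qed

lemma degree_expansion_top:
  fixes b :: "nat \<Rightarrow> 'l poly"
  assumes "degree g = N" "lead_coeff g = 1" "\<And>k. degree (b k) < N" "b K \<noteq> 0"
  shows "degree (\<Sum>k<Suc K. b k * g ^ k) = degree (b K) + K * N"
    and "lead_coeff (\<Sum>k<Suc K. b k * g ^ k) = lead_coeff (b K)"
proof -
  have g0: "g \<noteq> 0" using assms(2) by auto
  have dtop: "degree (b K * g ^ K) = degree (b K) + K * N"
    using g0 assms(1,4) by (simp add: degree_mult_eq degree_power_eq)
  have ltop: "lead_coeff (b K * g ^ K) = lead_coeff (b K)"
    using assms(2) by (simp only: lead_coeff_mult lead_coeff_power) simp
  consider "K = 0" | "degree (\<Sum>k<K. b k * g ^ k) < degree (b K * g ^ K)"
    using degree_expansion_less[of g N b K] assms(1,3) dtop by fastforce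
  then have "degree (\<Sum>k<Suc K. b k * g ^ k) = degree (b K) + K * N \<and>
    lead_coeff (\<Sum>k<Suc K. b k * g ^ k) = lead_coeff (b K)"
  proof cases
    case 1 then show ?thesis by simp
  next
    case 2
    then have "degree (\<Sum>k<Suc K. b k * g ^ k) = degree (b K * g ^ K)"
      by (simp add: degree_add_eq_right)
    moreover have "lead_coeff (\<Sum>k<Suc K. b k * g ^ k) = lead_coeff (b K * g ^ K)"
      using lead_coeff_add_le[OF 2] by simp
    ultimately show ?thesis using dtop ltop by simp
  qed
  then show "degree (\<Sum>k<Suc K. b k * g ^ k) = degree (b K) + K * N"
    "lead_coeff (\<Sum>k<Suc K. b k * g ^ k) = lead_coeff (b K)" by auto
qed

lemma degree_expansion_ge:
  fixes b :: "nat \<Rightarrow> 'l poly"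
  assumes "degree g = N" "lead_coeff g = 1" "\<And>k. degree (b k) < N" "b j \<noteq> 0" "j < K"
  shows "j * N \<le> degree (\<Sum>k<K. b k * g ^ k)"
  using assms(5)
proof (induction K)
  case (Suc K)
  show ?case
  proof (cases "b K = 0")
    case True
    then have "j < K" using Suc.prems assms(4) by (metis less_SucE)
    then show ?thesis using Suc.IH True by simp
  next
    case False
    have "j * N \<le> K * N" using Suc.prems by (intro mult_right_mono) auto
    then show ?thesis using degree_expansion_top(1)[where b = b, OF assms(1,2) assms(3) False] by linarith
  qed
qed simp

text \<open>A key polynomial \<open>g\<close> of MacLane defines a valuation on polynomials through \<open>g\<close>-adic expansions;
  these are the polynomials on which it is at most \<open>C\<close>.\<close>

inductive_set bounded_exp :: "'l \<Rightarrow> 'l poly \<Rightarrow> int \<Rightarrow> 'l poly set" for V g C where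
  zero: "0 \<in> bounded_exp V g C"
| step: "\<lbrakk>b \<in> polyF; degree b < degree g; dg_le (poly b V) (C - int k * dg (poly g V)); P \<in> bounded_exp V g C\<rbrakk>
    \<Longrightarrow> b * g ^ k + P \<in> bounded_exp V g C"

lemma bounded_exp_single:
  "\<lbrakk>b \<in> polyF; degree b < degree g; dg_le (poly b V) (C - int k * dg (poly g V))\<rbrakk> \<Longrightarrow> b * g ^ k \<in> bounded_exp V g C"
  using bounded_exp.step[of b g V C k 0] bounded_exp.zero by simp

lemma bounded_exp_add: "P \<in> bounded_exp V g C \<Longrightarrow> Q \<in> bounded_exp V g C \<Longrightarrow> P + Q \<in> bounded_exp V g C"
  by (induction P rule: bounded_exp.induct) (auto simp: add.assoc intro: bounded_exp.step)

lemma bounded_exp_sum: "(\<And>i. i \<in> I \<Longrightarrow> P i \<in> bounded_exp V g C) \<Longrightarrow> sum P I \<in> bounded_exp V g C"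
  by (induction I rule: infinite_finite_induct) (auto intro: bounded_exp.zero bounded_exp_add)

lemma bounded_exp_mono: "P \<in> bounded_exp V g C \<Longrightarrow> C \<le> C' \<Longrightarrow> P \<in> bounded_exp V g C'"
proof (induction P rule: bounded_exp.induct)
  case (step b k P)
  then show ?case by (intro bounded_exp.step) (auto elim: dg_le_mono)
qed (rule bounded_exp.zero)

text \<open>The inductive set allows several digits at one exponent, which makes closure under sums
  and products easy. Merging the digits of equal exponents recovers an ordinary g-adic expansion
  with the same bounds.\<close>

lemma bounded_exp_normal:
  assumes "P \<in> bounded_exp V g C" "degree g > 0"
  shows "\<exists>b K. (\<forall>k. b k \<in> polyF \<and> degree (b k) < degree g \<and> dg_le (poly (b k) V) (C - int k * dg (poly g V))) \<and>
    (\<forall>k\<ge>K. b k = 0) \<and> P = (\<Sum>k<K. b k * g ^ k)"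
  using assms(1)
proof induction
  case zero
  then show ?case using assms(2) polyF_0 by (intro exI[of _ "\<lambda>_. 0"] exI[of _ 0]) auto
next
  case (step c j P)
  then obtain b K where b: "\<And>k. b k \<in> polyF \<and> degree (b k) < degree g \<and> dg_le (poly (b k) V) (C - int k * dg (poly g V))"
    "\<And>k. k \<ge> K \<Longrightarrow> b k = 0" "P = (\<Sum>k<K. b k * g ^ k)" by blast
  define b' where "b' = (\<lambda>k. b k + (if k = j then c else 0))"
  define K' where "K' = max K (Suc j)"
  have "b' k \<in> polyF \<and> degree (b' k) < degree g \<and> dg_le (poly (b' k) V) (C - int k * dg (poly g V))" for k
    using b(1)[of k] step.hyps(1-3) by (auto simp: b'_def intro: polyF_add degree_add_less dg_le_add)
  moreover have "\<forall>k\<ge>K'. b' k = 0" using b(2) by (auto simp: b'_def K'_def)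
  moreover have "c * g ^ j + P = (\<Sum>k<K'. b' k * g ^ k)"
  proof -
    have "(\<Sum>k<K'. b' k * g ^ k) = (\<Sum>k<K'. b k * g ^ k) + (\<Sum>k<K'. (if k = j then c * g ^ k else 0))"
      unfolding sum.distrib[symmetric] b'_def by (intro sum.cong) (auto simp: algebra_simps)
    also have "(\<Sum>k<K'. (if k = j then c * g ^ k else 0)) = c * g ^ j"
      by (simp add: K'_def)
    also have "(\<Sum>k<K'. b k * g ^ k) = P" unfolding b(3)
      by (intro sum.mono_neutral_right) (auto simp: K'_def b(2))
    finally show ?thesis by simp
  qed
  ultimately show ?case by blast
qed

section \<open>Stages of the tower, where g-adic terms cannot cancel\<close>

definition level :: "'l \<Rightarrow> nat \<Rightarrow> int \<Rightarrow> bool" where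
  "level V N D \<longleftrightarrow> N > 0 \<and> D > 0 \<and>
     (\<forall>G\<in>polyF. degree G < N \<longrightarrow> G \<noteq> 0 \<longrightarrow> poly G V \<noteq> 0 \<and> D dvd dg (poly G V))"

text \<open>In the tower \<open>N * D = n\<close>, and the degrees of values of polynomials of
  degree below \<open>N\<close> lie in the group generated by \<open>D\<close>. A key polynomial is
  a monic one of the next degree whose value leaves that group.\<close>

definition key_poly :: "'l \<Rightarrow> nat \<Rightarrow> int \<Rightarrow> 'l poly \<Rightarrow> bool" where
  "key_poly V N D g \<longleftrightarrow> g \<in> polyF \<and> lead_coeff g = 1 \<and> degree g = N \<and> poly g V \<noteq> 0 \<and> \<not> D dvd dg (poly g V)"

text \<open>The values of \<open>e\<close> and \<open>e'\<close> have degrees divisible by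
  \<open>D\<close>, that of \<open>g\<close> does not; so \<open>e' * g\<close> and \<open>e\<close>
  have values of different degrees, and neither exceeds the bound on their sum. This carry is all
  that multiplying two expansions requires.\<close>

lemma bounded_exp_product:
  assumes "level V N D" "key_poly V N D g" "b \<in> polyF" "degree b < N" "c \<in> polyF" "degree c < N"
    "dg_le (poly b V) B" "dg_le (poly c V) C"
  shows "\<exists>e\<in>polyF. \<exists>e'\<in>polyF. degree e < N \<and> degree e' < N \<and> b * c = e' * g + e \<and> dg_le (poly e V) (B + C) \<and>
    dg_le (poly e' V) (B + C - dg (poly g V))"
proof -
  have g: "g \<in> polyF" "lead_coeff g = 1" "degree g = N" "poly g V \<noteq> 0" "\<not> D dvd dg (poly g V)"
    using assms(2) by (auto simp: key_poly_def)
  have N: "N > 0" using assms(1) by (simp add: level_def)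
  have L: "D dvd dg (poly G V)" if "G \<in> polyF" "degree G < N" "G \<noteq> 0" for G
    using assms(1) that by (auto simp: level_def)
  obtain e' e where e: "e' \<in> polyF" "e \<in> polyF" "b * c = e' * g + e" "degree e < N"
    "e' \<noteq> 0 \<longrightarrow> degree e' + N = degree (b * c)"
    using polyF_divide_monic[OF _ _ _ _ polyF_mult[OF assms(3,5)], of g N] g(1-3) N by blast
  have de': "degree e' < N"
    using e(5) degree_mult_le[of b c] assms(4,6) N by (cases "e' = 0") auto
  have dg_le: "dg_le (poly e' V * poly g V + poly e V) (B + C)"
    using dg_le_mult[OF assms(7,8)] by (simp flip: poly_mult poly_add add: e(3))
  have ne: "dg (poly e' V * poly g V) \<noteq> dg (poly e V)" if "poly e' V * poly g V \<noteq> 0" "poly e V \<noteq> 0"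
  proof
    assume eq: "dg (poly e' V * poly g V) = dg (poly e V)"
    have "e' \<noteq> 0" "e \<noteq> 0" using that by auto
    then have "D dvd dg (poly e' V)" "D dvd dg (poly e V)" using L[of e'] L[of e] e(1,2,4) de' by auto
    moreover have "dg (poly e V) = dg (poly e' V) + dg (poly g V)"
      using eq that by (simp add: dg_mult)
    ultimately have "D dvd dg (poly g V)" by (simp add: dvd_add_right_iff)
    then show False using g by simp
  qed
  have 1: "dg_le (poly e' V * poly g V) (B + C)" "dg_le (poly e V) (B + C)"
    using dg_le_add_distinct[OF ne dg_le] by auto
  from 1(1) have "dg_le (poly e' V) (B + C - dg (poly g V))"
    using g(4) by (cases "poly e' V = 0") (auto simp: dg_le_def dg_mult)
  then show ?thesis using e de' 1(2) by blast
qed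

lemma bounded_exp_mult:
  assumes "level V N D" "key_poly V N D g" "P \<in> bounded_exp V g B" "Q \<in> bounded_exp V g C"
  shows "P * Q \<in> bounded_exp V g (B + C)"
  using assms(3)
proof induction
  case zero show ?case by (simp add: bounded_exp.zero)
next
  case (step b k P)
  have dg: "degree g = N" using assms(2) by (simp add: key_poly_def)
  have "b * g ^ k * Q \<in> bounded_exp V g (B + C)" using assms(4)
  proof induction
    case zero show ?case by (simp add: bounded_exp.zero)
  next
    case (step c j Q)
    obtain e e' where e: "e \<in> polyF" "e' \<in> polyF" "degree e < N" "degree e' < N" "b * c = e' * g + e"
      "dg_le (poly e V) (B - int k * dg (poly g V) + (C - int j * dg (poly g V)))"
      "dg_le (poly e' V) (B - int k * dg (poly g V) + (C - int j * dg (poly g V)) - dg (poly g V))"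
      using bounded_exp_product[OF assms(1,2) \<open>b \<in> polyF\<close> \<open>degree b < degree g\<close>[unfolded dg] \<open>c \<in> polyF\<close>
          \<open>degree c < degree g\<close>[unfolded dg] \<open>dg_le (poly b V) _\<close> \<open>dg_le (poly c V) _\<close>] by blast
    have "b * g ^ k * (c * g ^ j) = (b * c) * g ^ (k + j)"
      by (simp add: power_add algebra_simps)
    also have "\<dots> = e' * g ^ Suc (k + j) + e * g ^ (k + j)"
      unfolding e(5) by (simp add: algebra_simps)
    also have "\<dots> \<in> bounded_exp V g (B + C)"
      using e dg by (intro bounded_exp_add bounded_exp_single) (auto simp: algebra_simps)
    finally show ?case using step by (simp add: ring_distribs bounded_exp_add)
  qed
  then show ?case using step by (simp add: ring_distribs bounded_exp_add)
qed

lemma bounded_exp_1: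
  assumes "level V N D" "key_poly V N D g" shows "1 \<in> bounded_exp V g 0"
  using bounded_exp_single[of 1 g V 0 0] assms by (simp add: level_def key_poly_def polyF_1 dg_le_def)

lemma bounded_exp_power:
  assumes "level V N D" "key_poly V N D g" "P \<in> bounded_exp V g B"
  shows "P ^ k \<in> bounded_exp V g (int k * B)"
proof (induction k)
  case 0 then show ?case using bounded_exp_1[OF assms(1,2)] by simp
next
  case (Suc k)
  then show ?case using bounded_exp_mult[OF assms(1,2) assms(3) Suc] by (simp add: algebra_simps)
qed

lemma bounded_exp_key:
  assumes "level V N D" "key_poly V N D g" shows "g \<in> bounded_exp V g (dg (poly g V))"
  using bounded_exp_single[of 1 g V "dg (poly g V)" 1] assms by (simp add: level_def key_poly_def polyF_1 dg_le_def)

lemma gcd_step: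
  assumes "(D::int) > 0" "D dvd k * d" shows "D div gcd D d dvd k"
proof -
  have "D div gcd D d dvd k * (d div gcd D d)"
  proof -
    let ?g = "gcd D d"
    have "?g * (D div ?g) = D" "?g * (d div ?g) = d" by simp_all
    then have "?g * (D div ?g) dvd ?g * (k * (d div ?g))"
      using assms(2) by (simp add: mult.left_commute)
    then show ?thesis using assms(1) by (subst (asm) dvd_mult_cancel_left) simp
  qed
  moreover have "coprime (D div gcd D d) (d div gcd D d)" using assms(1) by (intro div_gcd_coprime) auto
  ultimately show ?thesis by (simp add: coprime_dvd_mult_left_iff)
qed

text \<open>Terms with exponents i and j have degrees congruent modulo \<open>D\<close> only if
  \<open>D div gcd D (dg (poly g V))\<close> divides \<open>i - j\<close>, which is impossible for
  distinct exponents below \<open>q\<close>. So nothing cancels, and the digits see the true degree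
  of the value.\<close>

lemma expansion_distinct:
  assumes "level V N D" "key_poly V N D g" "\<And>k. b k \<in> polyF \<and> degree (b k) < N"
    "q = nat (D div gcd D (dg (poly g V)))" "G = (\<Sum>k<q. b k * g ^ k)" "G \<noteq> 0"
  shows "poly G V \<noteq> 0" "gcd D (dg (poly g V)) dvd dg (poly G V)"
    "\<And>k. k < q \<Longrightarrow> dg_le (poly (b k) V) (dg (poly G V) - int k * dg (poly g V))"
proof -
  note g = assms(2)[unfolded key_poly_def] and L = assms(1)[unfolded level_def]
  let ?d = "dg (poly g V)"
  define z where "z = (\<lambda>k. poly (b k) V * poly g V ^ k)"
  have z0: "z k \<noteq> 0 \<longleftrightarrow> b k \<noteq> 0" for k using g L assms(3)[of k] by (auto simp: z_def)
  have Gz: "poly G V = sum z {..<q}" by (simp add: assms(5) z_def poly_sum)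
  have dz: "dg (z k) = dg (poly (b k) V) + int k * ?d" if "b k \<noteq> 0" for k
    using z0[of k] that by (auto simp: z_def dg_mult dg_power)
  have Db: "D dvd dg (poly (b k) V)" if "b k \<noteq> 0" for k using L assms(3)[of k] that by auto
  have dist: "dg (z i) \<noteq> dg (z j)" if "i < q" "j < q" "i \<noteq> j" "z i \<noteq> 0" "z j \<noteq> 0" for i j
  proof
    assume "dg (z i) = dg (z j)"
    then have "(int i - int j) * ?d = dg (poly (b j) V) - dg (poly (b i) V)"
      using dz z0 that by (simp add: algebra_simps)
    then have "D dvd (int i - int j) * ?d" using Db z0 that by simp
    then have "D div gcd D ?d dvd int i - int j" using gcd_step L by blast
    moreover have "\<bar>int i - int j\<bar> < D div gcd D ?d" using that assms(4) by auto
    ultimately show False using that(3) dvd_imp_le_int[of "int i - int j" "D div gcd D ?d"] by auto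
  qed
  have "\<exists>k<q. b k \<noteq> 0"
  proof (rule ccontr)
    assume "\<not> ?thesis"
    then have "G = 0" unfolding assms(5) by (intro sum.neutral) auto
    then show False using assms(6) by simp
  qed
  then have "\<exists>k\<in>{..<q}. z k \<noteq> 0" using z0 by auto
  from sum_distinct[of "{..<q}" z, OF finite_lessThan _ this] dist
  have *: "sum z {..<q} \<noteq> 0" "\<exists>i\<in>{..<q}. z i \<noteq> 0 \<and> dg (sum z {..<q}) = dg (z i)"
    "\<forall>i\<in>{..<q}. z i \<noteq> 0 \<longrightarrow> dg (z i) \<le> dg (sum z {..<q})" by auto
  show "poly G V \<noteq> 0" using *(1) Gz by simp
  obtain i where i: "b i \<noteq> 0" "dg (poly G V) = dg (z i)" using *(2) Gz z0 by auto
  have "gcd D ?d dvd dg (poly (b i) V)" using Db[OF i(1)] by (meson dvd_trans gcd_dvd1)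
  then show "gcd D ?d dvd dg (poly G V)" using i dz by simp
  fix k assume "k < q"
  then show "dg_le (poly (b k) V) (dg (poly G V) - int k * dg (poly g V))"
    using *(3) dz[of k] z0[of k] Gz by (cases "b k = 0") (auto simp: dg_le_def)
qed

text \<open>Below the new degree bound only the exponents less than \<open>q\<close> occur, exactly
  the range without cancellation.\<close>

lemma level_step:
  assumes "level V N D" "key_poly V N D g"
  shows "level V (nat (D div gcd D (dg (poly g V))) * N) (gcd D (dg (poly g V)))"
proof -
  let ?D' = "gcd D (dg (poly g V))"
  have ND: "N > 0" "D > 0" using assms(1) by (auto simp: level_def)
  have D': "?D' > 0" using ND by simp
  then have q: "D div ?D' > 0" using ND by (simp add: pos_imp_zdiv_pos_iff zdvd_imp_le)
  have g: "g \<in> polyF" "lead_coeff g = 1" "degree g = N" using assms(2) by (auto simp: key_poly_def)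
  have "poly G V \<noteq> 0 \<and> ?D' dvd dg (poly G V)"
    if G: "G \<in> polyF" "degree G < nat (D div ?D') * N" "G \<noteq> 0" for G
  proof -
    obtain b where b: "\<And>k. b k \<in> polyF \<and> degree (b k) < N" "G = (\<Sum>k<nat (D div ?D'). b k * g ^ k)"
      using polyF_expand[OF g ND(1) G(1,2)] by blast
    from expansion_distinct[OF assms b(1) refl b(2) G(3)] show ?thesis by blast
  qed
  then show ?thesis using ND D' q by (simp add: level_def)
qed

lemma level_size: "D > 0 \<Longrightarrow> int N * D = n \<Longrightarrow> int (nat (D div gcd D d) * N) * gcd D d = n"
  by (simp add: mult.commute mult.left_commute pos_imp_zdiv_nonneg_iff)

lemma gcd_less: "\<lbrakk>(D::int) > 0; \<not> D dvd d\<rbrakk> \<Longrightarrow> gcd D d < D"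
  by (metis gcd_dvd1 gcd_dvd2 order_le_less zdvd_imp_le)

end

text \<open>To be applied with \<open>F = K(u)\<close> and \<open>A = K[u]\<close> inside the Laurent series in \<open>1/t\<close>, \<open>V = v\<close>,
  \<open>n = deg u\<close> and \<open>f\<close> the minimal polynomial of \<open>v\<close>.\<close>

locale valued_tower = valued_field dg F
  for dg :: "'l::field \<Rightarrow> int" and F :: "'l set" +
  fixes V :: 'l and n :: int and f :: "'l poly" and A :: "'l set"
  assumes F_dvd: "\<lbrakk>a \<in> F; a \<noteq> 0\<rbrakk> \<Longrightarrow> n dvd dg a"
    and n_pos: "n > 0"
    and f_PF: "f \<in> polyF" and f_monic: "lead_coeff f = 1" and f_root: "poly f V = 0"
    and f_min: "\<lbrakk>G \<in> polyF; G \<noteq> 0; degree G < degree f\<rbrakk> \<Longrightarrow> poly G V \<noteq> 0"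
    and next_degree: "\<lbrakk>D > 0; int N * D = n; N < degree f\<rbrakk> \<Longrightarrow>
      \<exists>G\<in>polyF. G \<noteq> 0 \<and> degree G \<le> N \<and> \<not> D dvd dg (poly G V)"
    and A_1: "1 \<in> A" and A_add: "\<lbrakk>a \<in> A; b \<in> A\<rbrakk> \<Longrightarrow> a + b \<in> A"
    and A_uminus: "a \<in> A \<Longrightarrow> - a \<in> A"
    and A_mult: "\<lbrakk>a \<in> A; b \<in> A\<rbrakk> \<Longrightarrow> a * b \<in> A"
    and A_div: "\<lbrakk>of_nat k * a \<in> A; k > 0\<rbrakk> \<Longrightarrow> a \<in> A"
    and of_nat_nonzero: "k > 0 \<Longrightarrow> of_nat k \<noteq> (0::'l)"
    and f_A: "coeff f i \<in> A"
    and A_nonneg: "\<lbrakk>\<And>i. coeff G i \<in> A; poly G V \<noteq> 0\<rbrakk> \<Longrightarrow> dg (poly G V) \<ge> 0"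
begin

section \<open>The tower of key polynomials below f\<close>

lemma of_nat_F: "of_nat k \<in> F"
  by (induction k) (auto intro: F_0 F_1 F_add)

lemma level_1: "level V 1 n"
proof -
  have "poly G V \<noteq> 0 \<and> n dvd dg (poly G V)" if G: "G \<in> polyF" "degree G = 0" "G \<noteq> 0" for G
  proof -
    obtain c where "G = [:c:]" using G(2) by (metis degree_eq_zeroE)
    then have "c \<in> F" "c \<noteq> 0" using G by (auto simp: polyF_def dest: spec[of _ 0])
    then show ?thesis using F_dvd \<open>G = [:c:]\<close> by simp
  qed
  then show ?thesis using n_pos by (simp add: level_def)
qed

lemma f_nonzero: "f \<noteq> 0" using f_monic by auto

lemma level_le_degree:
  assumes "level V N D" shows "N \<le> degree f"
  using assms f_PF f_root f_nonzero by (force simp: level_def)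

text \<open>The level condition forces the polynomial from \<open>next_degree\<close> to have degree
  exactly \<open>N\<close>. Making it monic multiplies its value by a constant of \<open>F\<close>,
  whose degree is a multiple of \<open>D\<close>.\<close>

lemma key_poly_exists:
  assumes "level V N D" "int N * D = n" "N < degree f"
  shows "\<exists>g. key_poly V N D g"
proof -
  have ND: "N > 0" "D > 0" and L: "\<And>G. G \<in> polyF \<Longrightarrow> degree G < N \<Longrightarrow> G \<noteq> 0 \<Longrightarrow> D dvd dg (poly G V)"
    using assms(1) by (auto simp: level_def)
  obtain G where G: "G \<in> polyF" "G \<noteq> 0" "degree G \<le> N" "\<not> D dvd dg (poly G V)"
    using next_degree[OF ND(2) assms(2,3)] by blast
  have dG: "degree G = N" using L[OF G(1)] G by force
  have l: "lead_coeff G \<in> F" "lead_coeff G \<noteq> 0" using G by (auto simp: polyF_def)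
  have ev: "poly G V \<noteq> 0" using f_min[OF G(1,2)] dG assms(3) by simp
  define c where "c = inverse (lead_coeff G)"
  have c: "c \<in> F" "c \<noteq> 0" using l by (auto simp: c_def F_inverse)
  have "D dvd dg c" using L[of "[:c:]"] c ND by (simp add: polyF_const)
  then have "\<not> D dvd dg (poly (smult c G) V)"
    using G(4) ev c by (simp add: dg_mult dvd_add_right_iff)
  then have "key_poly V N D (smult c G)"
    using G(1) c dG ev l by (simp add: key_poly_def polyF_smult c_def)
  then show ?thesis ..
qed

text \<open>By induction from the top of the tower, where \<open>f\<close> itself is the next key polynomial.\<close>

lemma f_bounded_exp:
  assumes "level V N D" "int N * D = n" "N < degree f" "key_poly V N D g"
  shows "\<exists>d. degree f = d * N \<and> f \<in> bounded_exp V g (int d * dg (poly g V))"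
  using assms
proof (induction "nat D" arbitrary: D N g rule: less_induct)
  case less
  let ?d = "dg (poly g V)"
  let ?D' = "gcd D ?d"
  define q where "q = nat (D div ?D')"
  let ?N' = "q * N"
  have ND: "N > 0" "D > 0" using less.prems(1) by (auto simp: level_def)
  have g: "g \<in> polyF" "lead_coeff g = 1" "degree g = N" "poly g V \<noteq> 0" "\<not> D dvd ?d"
    using less.prems(4) by (auto simp: key_poly_def)
  have L': "level V ?N' ?D'" using level_step[OF less.prems(1,4)] by (simp add: q_def)
  have D'less: "?D' < D" using gcd_less[OF ND(2) g(5)] .
  have qd: "?D' dvd int q * ?d" by simp
  have size: "int ?N' * ?D' = n" using level_size[OF ND(2) less.prems(2), of ?d] by (simp add: q_def)
  have q0: "q > 0" using L' ND by (simp add: level_def)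
  have evgq: "poly (g ^ q) V \<noteq> 0" "dg (poly (g ^ q) V) = int q * ?d"
    using g by (auto simp: dg_power)
  have dgq: "degree (g ^ q) = ?N'" using g by (subst degree_power_eq) auto
  have lgq: "lead_coeff (g ^ q) = 1" using g by (simp add: lead_coeff_power)
  have gqS: "g ^ q \<in> bounded_exp V g (int q * ?d)"
    using bounded_exp_power[OF less.prems(1,4) bounded_exp_key[OF less.prems(1,4)]] .
  \<comment> \<open>Below degree \<open>q * N\<close> nothing cancels, so the valuation defined by
    \<open>g\<close> agrees with the degree of the value.\<close>
  have smallS: "G \<in> bounded_exp V g C" if G: "G \<in> polyF" "degree G < ?N'" "dg_le (poly G V) C" for G C
  proof (cases "G = 0")
    case True then show ?thesis by (simp add: bounded_exp.zero)
  next
    case False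
    obtain b where b: "\<And>k. b k \<in> polyF \<and> degree (b k) < N" "G = (\<Sum>k<q. b k * g ^ k)"
      using polyF_expand[OF g(1-3) ND(1) G(1,2)] by blast
    note * = expansion_distinct[OF less.prems(1,4) b(1) _ b(2) False, unfolded q_def[symmetric], OF refl]
    have "dg (poly G V) \<le> C" using *(1) G(3) by (simp add: dg_le_def)
    then have "b k * g ^ k \<in> bounded_exp V g C" if "k < q" for k
      using *(3)[OF that] b(1)[of k] g(3) by (intro bounded_exp_single) (auto elim: dg_le_mono)
    then show ?thesis unfolding b(2) by (intro bounded_exp_sum) auto
  qed
  show ?case
  proof (cases "?N' < degree f")
    case False
    then have N': "degree f = ?N'" using level_le_degree[OF L'] by simp
    \<comment> \<open>Since \<open>f\<close> vanishes at \<open>V\<close>, the remainder has the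
      same value as \<open>- (g ^ q)\<close>.\<close>
    let ?h = "f - g ^ q"
    have "degree ?h < ?N'" using N' dgq f_monic lgq q0 ND by (intro degree_diff_lead_less) auto
    moreover have "dg_le (poly ?h V) (int q * ?d)" using evgq f_root by (simp add: dg_le_def)
    ultimately have "?h \<in> bounded_exp V g (int q * ?d)" using f_PF g(1) by (intro smallS polyF_diff polyF_power)
    from bounded_exp_add[OF gqS this] have "f \<in> bounded_exp V g (int q * ?d)" by simp
    then show ?thesis using N' by blast
  next
    case True
    obtain g' where g': "key_poly V ?N' ?D' g'" using key_poly_exists[OF L' size True] by blast
    then have g'': "g' \<in> polyF" "lead_coeff g' = 1" "degree g' = ?N'" "poly g' V \<noteq> 0"
      "\<not> ?D' dvd dg (poly g' V)" by (auto simp: key_poly_def)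
    let ?d' = "dg (poly g' V)"
    obtain d' where d': "degree f = d' * ?N'" "f \<in> bounded_exp V g' (int d' * ?d')"
      using less.hyps[OF _ L' size True g'] D'less ND by auto
    let ?h = "g' - g ^ q"
    have dh: "degree ?h < ?N'" using g'' dgq lgq q0 ND by (intro degree_diff_lead_less) auto
    have hPF: "?h \<in> polyF" using g'' g by (intro polyF_diff polyF_power)
    \<comment> \<open>If \<open>?h\<close> dominated, the value of \<open>g'\<close> would have the
      degree of that of \<open>?h\<close>, a multiple of \<open>?D'\<close>.\<close>
    have le_h: "dg_le (poly ?h V) (int q * ?d)"
    proof (rule ccontr)
      assume *: "\<not> ?thesis"
      then have h0: "poly ?h V \<noteq> 0" and "int q * ?d < dg (poly ?h V)" by (auto simp: dg_le_def)
      then have "dg (poly (g ^ q) V + poly ?h V) = dg (poly ?h V)"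
        using evgq by (intro dg_add_less) auto
      moreover have "?D' dvd dg (poly ?h V)" using L' hPF dh h0 by (auto simp: level_def)
      ultimately show False using g''(5) by simp
    qed
    have "?h \<in> bounded_exp V g (int q * ?d)" using smallS[OF hPF dh le_h] .
    from bounded_exp_add[OF gqS this] have g'S: "g' \<in> bounded_exp V g (int q * ?d)" by simp
    have "poly (g ^ q) V + poly ?h V = poly g' V" by simp
    then have "dg_le (poly g' V) (int q * ?d)"
      using dg_le_add[OF _ le_h, of "poly (g ^ q) V"] evgq by (simp add: dg_le_def)
    then have d'le: "?d' \<le> int q * ?d" using g'' by (simp add: dg_le_def)
    obtain a K where a: "\<And>k. a k \<in> polyF \<and> degree (a k) < degree g' \<and> dg_le (poly (a k) V) (int d' * ?d' - int k * ?d')"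
      "f = (\<Sum>k<K. a k * g' ^ k)"
      using bounded_exp_normal[OF d'(2)] g''(3) q0 ND by (simp del: mult_Suc) blast
    \<comment> \<open>Digits and powers of \<open>g'\<close> are expanded again in powers of
      \<open>g\<close>. Because \<open>?d' \<le> int q * ?d\<close>, the resulting bound is largest
      for \<open>k = d'\<close>.\<close>
    have "a k * g' ^ k \<in> bounded_exp V g (int d' * (int q * ?d))" if "k < K" for k
    proof (cases "a k = 0")
      case True then show ?thesis by (simp add: bounded_exp.zero)
    next
      case False
      have "k * ?N' \<le> d' * ?N'"
        using degree_expansion_ge[of g' ?N' a k K] a False that g'' d'(1) by simp
      then have kd: "k \<le> d'" using q0 ND by simp
      have "a k \<in> bounded_exp V g (int d' * ?d' - int k * ?d')" using a(1)[of k] g''(3) by (intro smallS) auto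
      from bounded_exp_mult[OF less.prems(1,4) this bounded_exp_power[OF less.prems(1,4) g'S, of k]]
      have "a k * g' ^ k \<in> bounded_exp V g (int d' * ?d' - int k * ?d' + int k * (int q * ?d))" .
      moreover have "int d' * ?d' - int k * ?d' + int k * (int q * ?d) \<le> int d' * (int q * ?d)"
      proof -
        have "(int d' - int k) * ?d' \<le> (int d' - int k) * (int q * ?d)"
          using kd d'le by (intro mult_left_mono) auto
        then show ?thesis by (simp add: algebra_simps)
      qed
      ultimately show ?thesis by (rule bounded_exp_mono)
    qed
    then have "f \<in> bounded_exp V g (int d' * (int q * ?d))" unfolding a(2) by (intro bounded_exp_sum) auto
    then show ?thesis using d'(1) by (intro exI[of _ "d' * q"]) (simp add: mult.assoc)
  qed
qed

section \<open>Integral key polynomials\<close>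

lemma A_0: "0 \<in> A" using A_add[OF A_1 A_uminus[OF A_1]] by simp

lemma A_sum: "(\<And>i. i \<in> I \<Longrightarrow> a i \<in> A) \<Longrightarrow> sum a I \<in> A"
  by (induction I rule: infinite_finite_induct) (auto intro: A_0 A_add)

lemma A_of_nat: "of_nat k \<in> A"
  by (induction k) (auto intro: A_0 A_1 A_add)

lemma A_coeff_power:
  assumes "\<And>i. coeff p i \<in> A" shows "coeff (p ^ k) i \<in> A"
proof (induction k arbitrary: i)
  case 0 show ?case by (auto simp: A_0 A_1 coeff_1)
next
  case (Suc k) then show ?case by (auto simp: coeff_mult assms intro!: A_sum A_mult)
qed

text \<open>The ultrametric inequality bounds the degree above by 0; membership in \<open>A\<close>
  bounds it below.\<close>

lemma dg_of_nat: "k > 0 \<Longrightarrow> dg (of_nat k) = 0"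
proof -
  assume k: "k > 0"
  have "dg_le (of_nat k) 0"
    by (induction k) (auto intro!: dg_le_add simp: dg_le_def[of 1])
  moreover have "coeff [:of_nat k:] i \<in> A" for i
    by (cases i) (auto simp: A_of_nat A_0)
  ultimately show ?thesis using A_nonneg[of "[:of_nat k:]"] of_nat_nonzero[OF k] by (simp add: dg_le_def)
qed

text \<open>The top coefficients of \<open>g\<close> are determined recursively by those of \<open>g ^ d\<close>: the coefficient of
  \<open>g ^ d\<close> in degree \<open>(d - 1) * N + i\<close> is \<open>d\<close> times that of \<open>g\<close> in degree \<open>i\<close>, up to terms in the
  higher coefficients of \<open>g\<close>.\<close>

lemma approximate_root_integral:
  assumes "lead_coeff g = 1" "degree g = N" "d \<ge> 2" "degree (f - g ^ d) < (d - 1) * N"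
  shows "coeff g i \<in> A"
proof (rule ccontr)
  assume "coeff g i \<notin> A"
  define B where "B = {i. coeff g i \<notin> A}"
  have "B \<subseteq> {..N}"
  proof
    fix k assume "k \<in> B"
    then have "coeff g k \<noteq> 0" using A_0 by (auto simp: B_def)
    then show "k \<in> {..N}" using assms(2) le_degree by auto
  qed
  then have fin: "finite B" by (rule finite_subset) simp
  define j where "j = Max B"
  have jB: "coeff g j \<notin> A" and jmax: "\<And>k. k > j \<Longrightarrow> coeff g k \<in> A"
    using Max_in[OF fin] Max_ge[OF fin] \<open>coeff g i \<notin> A\<close> unfolding j_def B_def by force+
  have "j \<noteq> N" using jB assms(1,2) A_1 by auto
  then have jN: "j < N" using \<open>B \<subseteq> {..N}\<close> jB by (force simp: B_def)
  \<comment> \<open>Here \<open>x\<close> collects the coefficients above the highest bad one and so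
    lies over \<open>A\<close>; \<open>y\<close> is the rest, with the bad coefficient as its
    leading one.\<close>
  define y where "y = poly_cutoff (Suc j) g"
  define x where "x = g - y"
  have cy: "coeff y k = (if k \<le> j then coeff g k else 0)" for k
    by (simp add: y_def coeff_poly_cutoff less_Suc_eq_le)
  have cx: "coeff x k = (if k \<le> j then 0 else coeff g k)" for k by (simp add: x_def cy)
  have xA: "coeff x k \<in> A" for k using jmax by (simp add: cx A_0)
  have dy: "degree y = j"
    using jB A_0 by (intro antisym degree_le le_degree) (auto simp: cy)
  have cxN: "coeff x N = 1" using jN assms(1,2) by (simp add: cx)
  have dx: "degree x = N"
  proof (intro antisym degree_le le_degree)
    show "\<forall>k>N. coeff x k = 0" using assms(2) by (auto simp: cx coeff_eq_0)
  qed (simp add: cxN)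
  have lx: "lead_coeff x = 1" using cxN dx by simp
  have x0: "x \<noteq> 0" using lx by auto
  have dxp: "degree (x ^ (d - 1)) = (d - 1) * N" using dx x0 by (simp add: degree_power_eq)
  have lxp: "lead_coeff (x ^ (d - 1)) = 1" using lx by (simp add: lead_coeff_power)
  let ?E = "(x + y) ^ d - x ^ d - of_nat d * y * x ^ (d - 1)"
  let ?M = "j + (d - 1) * N"
  have "degree ?E \<le> 2 * j + (d - 2) * N"
    using power_add_linear_degree[of x N y j d] dx dy jN assms(3) by simp
  also have "\<dots> < ?M"
  proof -
    have "(d - 1) * N = N + (d - 2) * N" using assms(3) by (auto simp: le_iff_add)
    then show ?thesis using jN by simp
  qed
  finally have E: "coeff ?E ?M = 0" by (rule coeff_eq_0)
  have "coeff (f - g ^ d) ?M = 0" using assms(4) by (intro coeff_eq_0) simp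
  then have "coeff f ?M = coeff ((x + y) ^ d) ?M" by (simp add: x_def)
  also have "\<dots> = coeff (x ^ d) ?M + of_nat d * coeff (y * x ^ (d - 1)) ?M"
    using E by (simp add: mult.assoc of_nat_poly algebra_simps)
  also have "coeff (y * x ^ (d - 1)) ?M = coeff g j"
    using coeff_mult_degree_sum[of y "x ^ (d - 1)"] dy dxp lxp by (simp add: cy)
  finally have "of_nat d * coeff g j = coeff f ?M + - coeff (x ^ d) ?M" by simp
  also have "\<dots> \<in> A" by (intro A_add A_uminus f_A A_coeff_power xA)
  finally show False using A_div jB assms(3) by force
qed

text \<open>Tschirnhausen transformations turn \<open>g\<close> into the approximate \<open>d\<close>-th root of \<open>f\<close>.\<close>

lemma key_poly_integral:
  assumes "level V N D" "key_poly V N D g" "degree f = d * N" "N < degree f"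
    "f \<in> bounded_exp V g (int d * dg (poly g V))"
  shows "\<exists>g'. key_poly V N D g' \<and> (\<forall>i. coeff g' i \<in> A) \<and> dg (poly g' V) = dg (poly g V)"
  using assms(2,5)
proof (induction "degree (f - g ^ d)" arbitrary: g rule: less_induct)
  case less
  let ?d = "dg (poly g V)"
  have N: "N > 0" using assms(1) by (auto simp: level_def)
  have g: "g \<in> polyF" "lead_coeff g = 1" "degree g = N" "poly g V \<noteq> 0" "\<not> D dvd ?d"
    using less.prems(1) by (auto simp: key_poly_def)
  have d2: "d \<ge> 2" using assms(3,4) by (cases d; cases "d - 1") auto
  obtain b K where b: "\<And>k. b k \<in> polyF \<and> degree (b k) < N \<and> dg_le (poly (b k) V) (int d * ?d - int k * ?d)"
    "\<And>k. k \<ge> K \<Longrightarrow> b k = 0" "f = (\<Sum>k<K. b k * g ^ k)"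
    using bounded_exp_normal[OF less.prems(2), unfolded g(3), OF N] by blast
  have bdeg: "degree (b k) < N" for k using b(1) by blast
  have bd: "b k = 0" if "k > d" for k
  proof (rule ccontr)
    assume k: "b k \<noteq> 0"
    then have "k < K" using b(2)[of k] by force
    from degree_expansion_ge[where b = b, OF g(3,2) bdeg k this] have "k * N \<le> d * N"
      using assms(3) by (simp flip: b(3))
    then show False using that N by simp
  qed
  have "f = (\<Sum>k<max K (Suc d). b k * g ^ k)"
    unfolding b(3) by (intro sum.mono_neutral_left) (auto simp: b(2))
  also have "\<dots> = (\<Sum>k<Suc d. b k * g ^ k)"
    by (intro sum.mono_neutral_right) (auto simp: bd)
  finally have f1: "f = (\<Sum>k<Suc d. b k * g ^ k)" .
  have "b d \<noteq> 0"
  proof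
    assume "b d = 0"
    then have "f = (\<Sum>k<d. b k * g ^ k)" using f1 by simp
    then show False using degree_expansion_less[where b = b and K = d, OF g(3) bdeg] d2 assms(3) by simp
  qed
  from degree_expansion_top[where b = b, OF g(3,2) bdeg this, folded f1]
  have "degree (b d) = 0" "lead_coeff (b d) = 1" using assms(3) f_monic by auto
  then have "b d = 1" using monic_degree_0 by blast
  then have f2: "f - g ^ d = (\<Sum>k<d. b k * g ^ k)" using f1 by simp
  \<comment> \<open>The digit just below the top. If it vanishes, \<open>g\<close> is already the
    approximate root; otherwise adding \<open>a / d\<close> to \<open>g\<close> removes it up to
    terms of lower degree.\<close>
  define a where "a = b (d - 1)"
  have Sd: "Suc (d - 1) = d" using d2 by simp
  have f3: "f - g ^ d = (\<Sum>k<d-1. b k * g ^ k) + a * g ^ (d - 1)"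
    unfolding f2 a_def by (subst Sd[symmetric], subst sum.lessThan_Suc) simp
  have low: "degree (\<Sum>k<d-1. b k * g ^ k) < (d - 1) * N"
    using degree_expansion_less[where b = b and K = "d - 1", OF g(3) bdeg] d2 by simp
  show ?case
  proof (cases "a = 0")
    case True
    then have "coeff g i \<in> A" for i
      using approximate_root_integral[OF g(2,3) d2] f3 low by simp
    then show ?thesis using less.prems(1) by blast
  next
    case False
    have aPF: "a \<in> polyF" "degree a < N" using b(1) by (auto simp: a_def)
    have eva: "poly a V \<noteq> 0" "D dvd dg (poly a V)"
      using assms(1) aPF False by (auto simp: level_def)
    have "dg_le (poly a V) (int d * ?d - int (d - 1) * ?d)" using b(1) by (simp add: a_def)
    then have "dg (poly a V) \<le> ?d" using eva(1) d2 by (simp add: dg_le_def of_nat_diff algebra_simps)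
    \<comment> \<open>Equality is impossible because \<open>D\<close> divides only the left-hand
      degree. Hence the correction does not change the degree of the value of
      \<open>g\<close>.\<close>
    then have alt: "dg (poly a V) < ?d" using eva(2) g(5) by (metis order_le_less)
    have "degree (f - g ^ d) = degree a + (d - 1) * N"
      using degree_expansion_top(1)[where b = b and K = "d - 1", OF g(3,2) bdeg] False
      unfolding f2 a_def Sd by simp
    have d0: "of_nat d \<noteq> (0::'l)" using of_nat_nonzero d2 by simp
    define c where "c = inverse (of_nat d :: 'l)"
    have c: "c \<in> F" "c \<noteq> 0" "dg c = 0"
    proof -
      show "c \<in> F" "c \<noteq> 0" using d0 by (auto simp: c_def F_inverse of_nat_F)
      then have "dg (of_nat d * c) = dg (of_nat d) + dg c" using d0 by (intro dg_mult) auto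
      then show "dg c = 0" using d0 d2 by (simp add: c_def dg_of_nat)
    qed
    define g1 where "g1 = g + smult c a"
    have ca: "smult c a \<in> polyF" "degree (smult c a) < N" "poly (smult c a) V \<noteq> 0"
      "dg (poly (smult c a) V) < ?d"
      using aPF c eva alt by (auto simp: polyF_smult dg_mult)
    have ev1: "poly g1 V \<noteq> 0" "dg (poly g1 V) = ?d"
      using dg_add_less[OF ca(3) g(4) ca(4)] by (auto simp: g1_def add.commute)
    have dg1: "degree g1 = N" "lead_coeff g1 = 1"
    proof -
      show "degree g1 = N" using ca(2) g(3) by (simp add: g1_def degree_add_eq_left)
      show "lead_coeff g1 = 1" using lead_coeff_add_le[of "smult c a" g] ca(2) g
        by (simp add: g1_def add.commute)
    qed
    have k1: "key_poly V N D g1" using ev1 dg1 g ca(1) by (simp add: key_poly_def g1_def polyF_add)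
    have "g1 + smult (- c) a \<in> bounded_exp V g1 ?d"
    proof (rule bounded_exp_add)
      show "g1 \<in> bounded_exp V g1 ?d" using bounded_exp_key[OF assms(1) k1] ev1 by simp
      have "smult (- c) a * g1 ^ 0 \<in> bounded_exp V g1 ?d"
        using ca dg1 aPF c by (intro bounded_exp_single polyF_smult F_uminus) (auto simp: dg_le_def)
      then show "smult (- c) a \<in> bounded_exp V g1 ?d" by simp
    qed
    \<comment> \<open>The induction hypothesis needs the bound on \<open>f\<close> relative to the
      new key polynomial, so the old one is expanded in powers of \<open>g1\<close>.\<close>
    then have gS: "g \<in> bounded_exp V g1 ?d" by (simp add: g1_def)
    have "b k * g ^ k \<in> bounded_exp V g1 (int d * ?d)" for k
    proof -
      have "b k * g1 ^ 0 \<in> bounded_exp V g1 (int d * ?d - int k * ?d)"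
        using b(1)[of k] dg1 by (intro bounded_exp_single) auto
      then have "b k \<in> bounded_exp V g1 (int d * ?d - int k * ?d)" by simp
      from bounded_exp_mult[OF assms(1) k1 this bounded_exp_power[OF assms(1) k1 gS, of k]] show ?thesis by simp
    qed
    then have fS: "f \<in> bounded_exp V g1 (int d * dg (poly g1 V))" unfolding f1 ev1 by (intro bounded_exp_sum)
    let ?E = "(g + smult c a) ^ d - g ^ d - of_nat d * smult c a * g ^ (d - 1)"
    have "of_nat d * smult c a = a" using d0 by (simp add: c_def of_nat_poly)
    then have "f - g1 ^ d = (\<Sum>k<d-1. b k * g ^ k) - ?E"
      using f3 by (simp add: g1_def algebra_simps)
    moreover have "degree ?E < degree a + (d - 1) * N"
    proof -
      have "degree ?E \<le> 2 * degree a + (d - 2) * N"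
        using power_add_linear_degree[of g N "smult c a" "degree a" d] g(3) aPF d2 by simp
      also have "\<dots> < degree a + (d - 1) * N"
      proof -
        have "(d - 1) * N = N + (d - 2) * N" using d2 by (auto simp: le_iff_add)
        then show ?thesis using aPF by simp
      qed
      finally show ?thesis .
    qed
    ultimately have "degree (f - g1 ^ d) < degree (f - g ^ d)"
      unfolding \<open>degree (f - g ^ d) = degree a + (d - 1) * N\<close>
      by (simp only:) (rule degree_diff_less[OF trans_less_add2[OF low]])
    from less.hyps[OF this k1 fS] show ?thesis using ev1 by simp
  qed
qed

text \<open>Since \<open>q * N - 1 = (q - 1) * N + (N - 1)\<close>, the top digit is again monic, of
  degree \<open>N - 1\<close>. Without cancellation its term, with \<open>q - 1\<close> factors
  \<open>g\<close>, bounds the degree of the value below.\<close>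

lemma monic_bound_step:
  assumes "level V N D" "key_poly V N D g" "q = nat (D div gcd D (dg (poly g V)))"
    and base: "\<And>G. \<lbrakk>G \<in> polyF; lead_coeff G = 1; degree G = N - 1\<rbrakk> \<Longrightarrow> c \<le> dg (poly G V)"
    and G: "G \<in> polyF" "lead_coeff G = 1" "degree G = q * N - 1"
  shows "c + (int q - 1) * dg (poly g V) \<le> dg (poly G V)"
proof -
  have N: "N > 0" using assms(1) by (auto simp: level_def)
  have g: "g \<in> polyF" "lead_coeff g = 1" "degree g = N" using assms(2) by (auto simp: key_poly_def)
  have qN: "q * N > 0" using level_step[OF assms(1,2)] assms(3) by (simp add: level_def)
  then obtain p where p: "q = Suc p" by (cases q) auto
  have G0: "G \<noteq> 0" using G by auto
  obtain b where b: "\<And>k. b k \<in> polyF \<and> degree (b k) < N" "G = (\<Sum>k<q. b k * g ^ k)"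
    using polyF_expand[OF g N G(1), of q] G(3) qN by auto
  have bdeg: "degree (b k) < N" for k using b(1) by blast
  have bp: "b p \<noteq> 0"
  proof
    assume "b p = 0"
    then have *: "G = (\<Sum>k<p. b k * g ^ k)" using b(2) p by simp
    then have "p > 0" using G0 by (cases p) auto
    then have "degree G < p * N" using degree_expansion_less[where b = b, OF g(3) bdeg, of p] * by simp
    then show False using G(3) p N by simp
  qed
  from degree_expansion_top[where b = b, OF g(3,2) bdeg this] b(2) p G
  have "degree (b p) = N - 1" "lead_coeff (b p) = 1" by auto
  with base b(1) have "c \<le> dg (poly (b p) V)" by blast
  moreover have "poly (b p) V \<noteq> 0" using assms(1) b(1)[of p] bp by (auto simp: level_def)
  ultimately show ?thesis
    using expansion_distinct(3)[OF assms(1,2) b(1) assms(3) b(2) G0, of p] p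
    by (simp add: dg_le_def algebra_simps)
qed

text \<open>Each stage adds a multiple of \<open>dg (poly g V)\<close>, which is nonnegative since
  an integral key polynomial has a value of the same degree. The climb ends when \<open>N\<close>
  reaches the degree of \<open>f\<close>.\<close>

lemma monic_bound:
  assumes "level V N D" "int N * D = n"
    and "\<And>G. \<lbrakk>G \<in> polyF; lead_coeff G = 1; degree G = N - 1\<rbrakk> \<Longrightarrow> c \<le> dg (poly G V)"
    and "G \<in> polyF" "lead_coeff G = 1" "degree G = degree f - 1"
  shows "c \<le> dg (poly G V)"
  using assms
proof (induction "nat D" arbitrary: N D rule: less_induct)
  case less
  have D: "D > 0" using less.prems(1) by (auto simp: level_def)
  show ?case
  proof (cases "N < degree f")
    case False
    then show ?thesis using less.prems level_le_degree[OF less.prems(1)] by auto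
  next
    case True
    obtain g where g: "key_poly V N D g" using key_poly_exists[OF less.prems(1,2) True] by blast
    obtain d where d: "degree f = d * N" "f \<in> bounded_exp V g (int d * dg (poly g V))"
      using f_bounded_exp[OF less.prems(1,2) True g] by blast
    obtain g' where "key_poly V N D g'" "\<And>i. coeff g' i \<in> A" "dg (poly g' V) = dg (poly g V)"
      using key_poly_integral[OF less.prems(1) g d(1) True d(2)] by blast
    then have nonneg: "dg (poly g V) \<ge> 0" using A_nonneg[of g'] by (simp add: key_poly_def)
    let ?D' = "gcd D (dg (poly g V))"
    let ?q = "nat (D div ?D')"
    have L': "level V (?q * N) ?D'" using level_step[OF less.prems(1) g] .
    have "?D' < D" using gcd_less D g by (simp add: key_poly_def)
    then have lt: "nat ?D' < nat D" using D by simp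
    have q: "?q > 0" using L' by (auto simp: level_def)
    show ?thesis
    proof (rule less.hyps[OF lt L' level_size[OF D less.prems(2)] _ less.prems(4-6)])
      fix G assume "G \<in> polyF" "lead_coeff G = 1" "degree G = ?q * N - 1"
      from monic_bound_step[OF less.prems(1) g refl less.prems(3) this]
      have "c + (int ?q - 1) * dg (poly g V) \<le> dg (poly G V)" .
      moreover have "(int ?q - 1) * dg (poly g V) \<ge> 0" using q nonneg by simp
      ultimately show "c \<le> dg (poly G V)" by linarith
    qed
  qed
qed

text \<open>As \<open>n\<close> does not divide \<open>dg V\<close>, the indeterminate is a key
  polynomial for level 1. Its step alone produces the bound, starting from 0 for the constant
  polynomial 1; later steps preserve it.\<close>

theorem monic_codegree_one_bound:
  assumes "V \<noteq> 0" "\<not> n dvd dg V" "G \<in> polyF" "lead_coeff G = 1" "degree G = degree f - 1"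
  shows "(n div gcd n (dg V) - 1) * dg V \<le> dg (poly G V)"
proof -
  let ?g = "[:0, 1:] :: 'l poly"
  have k: "key_poly V 1 n ?g"
    using assms(1,2) by (auto simp: key_poly_def polyF_def coeff_pCons F_0 F_1 split: nat.split)
  have [simp]: "poly ?g V = V" by simp
  let ?q = "nat (n div gcd n (dg V))"
  have q: "int ?q = n div gcd n (dg V)" using n_pos by (simp add: pos_imp_zdiv_nonneg_iff)
  have L': "level V ?q (gcd n (dg V))" using level_step[OF level_1 k] by simp
  have size: "int ?q * gcd n (dg V) = n" using level_size[of n 1 n "dg V"] n_pos by simp
  show ?thesis
  proof (rule monic_bound[OF L' size _ assms(3-5)])
    fix G assume G: "G \<in> polyF" "lead_coeff G = 1" "degree G = ?q - 1"
    have "0 \<le> dg (poly G V)" if "lead_coeff G = 1" "degree G = 1 - 1" for G :: "'l poly"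
      using that monic_degree_0[of G] by simp
    from monic_bound_step[OF level_1 k refl this, of G] G
    show "(n div gcd n (dg V) - 1) * dg V \<le> dg (poly G V)"
      unfolding \<open>poly ?g V = V\<close> q by simp
  qed
qed

end

section \<open>Polynomial plane curves\<close>

text \<open>\<open>K[X, Y]\<close> is represented as \<open>K[X][Y]\<close>.\<close>

definition curve_eval :: "'k::field poly \<Rightarrow> 'k poly \<Rightarrow> 'k poly poly \<Rightarrow> 'k poly" where
  "curve_eval u v P = poly (map_poly (\<lambda>p. p \<circ>\<^sub>p u) P) v"

lemma comm_ring_hom_pcompose: "comm_ring_hom (\<lambda>p. p \<circ>\<^sub>p (u :: 'a::comm_ring_1 poly))"
  by unfold_locales (auto simp: pcompose_add pcompose_mult pcompose_1)

lemma comm_ring_hom_curve_eval: "comm_ring_hom (curve_eval u v)"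
proof -
  interpret comm_ring_hom "\<lambda>p. p \<circ>\<^sub>p u" by (rule comm_ring_hom_pcompose)
  interpret m: map_poly_comm_ring_hom "\<lambda>p. p \<circ>\<^sub>p u" ..
  show ?thesis by unfold_locales (auto simp: curve_eval_def m.hom_add m.hom_mult)
qed

interpretation curve_eval: comm_ring_hom "curve_eval u v" by (rule comm_ring_hom_curve_eval)

lemma curve_eval_pCons: "curve_eval u v (pCons p P) = p \<circ>\<^sub>p u + v * curve_eval u v P"
  by (cases "p = 0 \<and> P = 0") (auto simp: curve_eval_def map_poly_pCons)

lemma curve_eval_const [simp]: "curve_eval u v [:p:] = p \<circ>\<^sub>p u"
  by (simp add: curve_eval_pCons)

lemma curve_eval_smult: "curve_eval u v (smult p P) = (p \<circ>\<^sub>p u) * curve_eval u v P"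
  using curve_eval.hom_mult[of u v "[:p:]" P] by simp

lemma curve_eval_monom: "curve_eval u v (monom p k) = (p \<circ>\<^sub>p u) * v ^ k"
  by (induction k) (simp_all add: monom_0 monom_Suc curve_eval_pCons)

text \<open>Repeated division by \<open>u\<close> shows that \<open>K[t]\<close> is spanned over
  \<open>K[u]\<close> by the powers of t below the degree of \<open>u\<close>.\<close>

lemma expand_over_pcompose:
  fixes u p :: "'k::field poly"
  assumes "degree u > 0"
  shows "\<exists>c. p = (\<Sum>j<degree u. (c j \<circ>\<^sub>p u) * monom 1 j)"
proof (induction "degree p" arbitrary: p rule: less_induct)
  case less
  have r: "p mod u = (\<Sum>j<degree u. ([:coeff (p mod u) j:] \<circ>\<^sub>p u) * monom 1 j)"
  proof (rule poly_eqI)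
    fix i
    show "coeff (p mod u) i = coeff (\<Sum>j<degree u. ([:coeff (p mod u) j:] \<circ>\<^sub>p u) * monom 1 j) i"
    proof (cases "i < degree u")
      case True
      then show ?thesis by (simp add: coeff_sum if_distrib[of "(*) _"] cong: if_cong)
    next
      case False
      then have "coeff (p mod u) i = 0" using degree_mod_less[of u p] assms by (intro coeff_eq_0) force
      then show ?thesis using False by (simp add: coeff_sum if_distrib[of "(*) _"] cong: if_cong)
    qed
  qed
  show ?case
  proof (cases "degree p < degree u")
    case True
    then have "p mod u = p" by (rule mod_poly_less)
    then show ?thesis using r by metis
  next
    case False
    have "degree (p div u) < degree p"
    proof (cases "p div u = 0")
      case True then show ?thesis using False assms by simp
    next
      case nz: False
      have "degree ((p div u) * u) = degree (p div u) + degree u"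
        using nz assms by (intro degree_mult_eq) auto
      moreover have "(p div u) * u = p - p mod u" by (simp add: minus_mod_eq_div_mult)
      moreover have "degree (p - p mod u) \<le> degree p"
        using degree_mod_less[of u p] assms False by (intro degree_diff_le) force+
      ultimately show ?thesis using assms by simp
    qed
    then obtain c where c: "p div u = (\<Sum>j<degree u. (c j \<circ>\<^sub>p u) * monom 1 j)"
      using less.hyps by blast
    have "p = (p div u) * u + p mod u" by simp
    also have "\<dots> = (\<Sum>j<degree u. (([:0,1:] * c j + [:coeff (p mod u) j:]) \<circ>\<^sub>p u) * monom 1 j)"
      by (subst r, subst c)
        (simp add: pcompose_add pcompose_mult pcompose_pCons sum_distrib_right sum_distrib_left sum.distrib[symmetric] algebra_simps)
    finally show ?thesis by (rule exI[of _ "\<lambda>j. [:0,1:] * c j + [:coeff (p mod u) j:]"])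
  qed
qed

text \<open>The determinant trick: \<open>v\<close> is an eigenvalue of the matrix of multiplication
  by \<open>v\<close> on the finite \<open>K[u]\<close>-module \<open>K[t]\<close>, with eigenvector
  \<open>(1, t, t^2, ...)\<close>. Lifted to \<open>K[X]\<close>, the characteristic polynomial is
  the relation.\<close>

lemma monic_relation_exists:
  fixes u v :: "'k::field poly"
  assumes "degree u > 0"
  shows "\<exists>P. lead_coeff P = 1 \<and> curve_eval u v P = 0"
proof -
  let ?n = "degree u"
  interpret h: comm_ring_hom "\<lambda>p. p \<circ>\<^sub>p u" by (rule comm_ring_hom_pcompose)
  interpret m: map_poly_comm_ring_hom "\<lambda>p. p \<circ>\<^sub>p u" ..
  have "\<exists>c. v * monom 1 i = (\<Sum>j<?n. (c j \<circ>\<^sub>p u) * monom 1 j)" for i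
    by (rule expand_over_pcompose[OF assms])
  then obtain c where c: "\<And>i. v * monom 1 i = (\<Sum>j<?n. (c i j \<circ>\<^sub>p u) * monom 1 j)" by metis
  define M where "M = mat ?n ?n (\<lambda>(i, j). c i j)"
  have M: "M \<in> carrier_mat ?n ?n" by (simp add: M_def)
  define M' where "M' = map_mat (\<lambda>p. p \<circ>\<^sub>p u) M"
  have M': "M' \<in> carrier_mat ?n ?n" using M by (simp add: M'_def)
  let ?w = "vec ?n (\<lambda>j. monom 1 j :: 'k poly)"
  have "M' *\<^sub>v ?w = v \<cdot>\<^sub>v ?w"
    by (rule eq_vecI) (auto simp: M'_def M_def scalar_prod_def c atLeast0LessThan)
  moreover have "?w \<noteq> 0\<^sub>v ?n"
  proof
    assume "?w = 0\<^sub>v ?n"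
    from arg_cong[OF this, of "\<lambda>x. vec_index x 0"] show False using assms by simp
  qed
  ultimately have "\<exists>w\<in>carrier_vec ?n. w \<noteq> 0\<^sub>v ?n \<and> M' *\<^sub>v w = v \<cdot>\<^sub>v w" by auto
  then obtain w where w: "w \<in> carrier_vec ?n" "w \<noteq> 0\<^sub>v ?n" "M' *\<^sub>v w = v \<cdot>\<^sub>v w" by blast
  define C where "C = v \<cdot>\<^sub>m 1\<^sub>m ?n - M'"
  have C: "C \<in> carrier_mat ?n ?n" using M' by (simp add: C_def minus_carrier_mat)
  have "C *\<^sub>v w = 0\<^sub>v ?n"
  proof -
    have "(v \<cdot>\<^sub>m 1\<^sub>m ?n) *\<^sub>v w = v \<cdot>\<^sub>v w" by (rule eq_vecI) (use w(1) in auto)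
    then show ?thesis using M' w by (simp add: C_def minus_mult_distrib_mat_vec[of _ ?n ?n])
  qed
  then have "det C = 0" using det_0_iff_vec_prod_zero[OF C] w by blast
  moreover have "poly (char_poly M') v = det C"
    unfolding char_poly_def
    by (rule poly_det_cong) (use M' in \<open>auto simp: char_poly_matrix_def C_def\<close>)
  moreover have "char_poly M' = map_poly (\<lambda>p. p \<circ>\<^sub>p u) (char_poly M)"
    unfolding M'_def by (rule comm_ring_hom.char_poly_hom[OF comm_ring_hom_pcompose M])
  ultimately have "curve_eval u v (char_poly M) = 0" by (simp add: curve_eval_def)
  then show ?thesis using degree_monic_char_poly[OF M] by metis
qed

lemma irreducible_factor_exists:
  fixes c :: "'k::field poly"
  assumes "degree c > 0"
  shows "\<exists>p. irreducible p \<and> p dvd c \<and> degree p > 0"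
proof -
  define p where "p = (ARG_MIN degree p. p dvd c \<and> degree p > 0)"
  have p: "p dvd c" "degree p > 0" and min: "\<And>q. q dvd c \<Longrightarrow> degree q > 0 \<Longrightarrow> degree p \<le> degree q"
    using arg_min_nat_lemma[of "\<lambda>p. p dvd c \<and> degree p > 0" c degree] assms
    by (auto simp: p_def)
  have "irreducible p"
  proof (rule irreducibleI)
    fix a b assume ab: "p = a * b"
    have "p \<noteq> 0" using p by auto
    then have nz: "a \<noteq> 0" "b \<noteq> 0" using ab by auto
    show "is_unit a \<or> is_unit b"
    proof (cases "degree a = 0")
      case False
      then have "degree p \<le> degree a" using p ab by (intro min) (auto intro: dvd_mult_left)
      then have "degree b = 0" using ab nz by (simp add: degree_mult_eq)
      then show ?thesis using nz by (simp add: is_unit_iff_degree)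
    qed (use nz in \<open>simp add: is_unit_iff_degree\<close>)
  qed (use p in \<open>auto simp: is_unit_iff_degree\<close>)
  then show ?thesis using p by blast
qed

lemma divide_monic:
  fixes P Q :: "'a::comm_ring_1 poly"
  assumes "lead_coeff P = 1"
  shows "\<exists>A B. Q = P * A + B \<and> (B = 0 \<or> degree B < degree P)"
proof -
  obtain A B where AB: "pseudo_divmod Q P = (A, B)" by force
  have "P \<noteq> 0" using assms by auto
  from pseudo_divmod[OF this AB] assms show ?thesis by auto
qed

text \<open>Gauss's lemma, by hand, because polynomials over an abstract field have no normalised greatest
  common divisor: a relation of least degree divides a monic one up to a constant, and the irreducible
  factors of that constant can be cancelled.\<close>

lemma minimal_relation_exists:
  fixes u v :: "'k::field poly"
  assumes "degree u > 0"
  shows "\<exists>f. lead_coeff f = 1 \<and> curve_eval u v f = 0 \<and> (\<forall>P. curve_eval u v P = 0 \<longrightarrow> f dvd P)"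
proof -
  obtain f0 where f0: "lead_coeff f0 = 1" "curve_eval u v f0 = 0" using monic_relation_exists[OF assms] by blast
  have f0n: "f0 \<noteq> 0" using f0 by auto
  define R where "R = (\<lambda>P. P \<noteq> 0 \<and> curve_eval u v P = 0)"
  define m where "m = degree (ARG_MIN degree P. R P)"
  have m: "\<exists>P. R P \<and> degree P = m" "\<And>P. R P \<Longrightarrow> m \<le> degree P"
    using arg_min_nat_lemma[of R f0 degree] f0 f0n by (auto simp: m_def R_def)
  \<comment> \<open>The second minimisation makes \<open>P\<close> primitive: a nonconstant factor
    from \<open>K[X]\<close> could be cancelled and would lower the degree of the leading
    coefficient.\<close>
  define P where "P = (ARG_MIN (\<lambda>P. degree (lead_coeff P)) P. R P \<and> degree P = m)"
  have P: "R P" "degree P = m" "\<And>Q. R Q \<Longrightarrow> degree Q = m \<Longrightarrow> degree (lead_coeff P) \<le> degree (lead_coeff Q)"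
    using arg_min_nat_lemma[of "\<lambda>P. R P \<and> degree P = m" _ "\<lambda>P. degree (lead_coeff P)"] m(1)
    unfolding P_def by blast+
  have P0: "P \<noteq> 0" using P by (simp add: R_def)
  \<comment> \<open>These are the denominators that occur when \<open>f0\<close> is divided by
    \<open>P\<close>; one of least degree will turn out to be constant.\<close>
  define S where "S = (\<lambda>c. c \<noteq> 0 \<and> P dvd smult c f0)"
  have "\<exists>c. S c"
  proof -
    obtain A B where AB: "pseudo_divmod f0 P = (A, B)" by force
    from pseudo_divmod[OF P0 AB] obtain k where k: "smult (lead_coeff P ^ k) f0 = P * A + B"
      "B = 0 \<or> degree B < degree P" by auto
    have "curve_eval u v (smult (lead_coeff P ^ k) f0) = curve_eval u v (P * A + B)" using k by simp
    then have "curve_eval u v B = 0" using P(1) f0 by (simp add: curve_eval_smult curve_eval.hom_add curve_eval.hom_mult R_def)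
    then have "B = 0" using k(2) m(2)[of B] P(2) unfolding R_def by (metis not_le)
    then have "P dvd smult (lead_coeff P ^ k) f0" using k by simp
    moreover have "lead_coeff P ^ k \<noteq> 0" using P0 by simp
    ultimately show ?thesis unfolding S_def by blast
  qed
  then obtain c0 where "S c0" ..
  define c where "c = (ARG_MIN degree c. S c)"
  have c: "S c" "\<And>c'. S c' \<Longrightarrow> degree c \<le> degree c'"
    using arg_min_nat_lemma[of S c0 degree] \<open>S c0\<close> by (auto simp: c_def)
  obtain Q where Q: "smult c f0 = P * Q" using c(1) unfolding S_def dvd_def by blast
  have "degree c = 0"
  proof (rule ccontr)
    assume "degree c \<noteq> 0"
    then obtain p where p: "irreducible p" "p dvd c" "degree p > 0"
      using irreducible_factor_exists[of c] by auto
    obtain c' where c': "c = p * c'" using p(2) ..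
    have c'0: "c' \<noteq> 0" "p \<noteq> 0" using c' c(1) by (auto simp: S_def)
    have "prime_elem [:p:]" using p(1) by (intro lift_prime_elem_poly field_poly_irreducible_imp_prime)
    moreover have "P * Q = [:p:] * smult c' f0" unfolding Q[symmetric] c' by (simp add: mult.commute)
    then have "[:p:] dvd P * Q" by (rule dvdI)
    ultimately consider "[:p:] dvd P" | "[:p:] dvd Q" using prime_elem_dvd_multD by blast
    then show False
    proof cases
      case 1
      then obtain P' where P': "P = smult p P'" by (auto elim!: dvdE)
      have pu: "p \<circ>\<^sub>p u \<noteq> 0" using c'0 assms pcompose_eq_0 by blast
      have "R P'" using P(1) P' pu by (auto simp: R_def curve_eval_smult)
      moreover have "degree P' = m" using P(2) P' c'0 by simp
      ultimately have "degree (lead_coeff P) \<le> degree (lead_coeff P')" by (rule P(3))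
      moreover have "lead_coeff P = p * lead_coeff P'" using P' by (simp add: lead_coeff_smult)
      moreover have "lead_coeff P' \<noteq> 0" using P0 P' by auto
      ultimately show False using c'0 p(3) by (simp add: degree_mult_eq)
    next
      case 2
      then obtain Q' where Q': "Q = smult p Q'" by (auto elim!: dvdE)
      have "smult p (smult c' f0) = smult p (P * Q')" using Q c' Q' by simp
      then have "smult p (smult c' f0 - P * Q') = 0" by (simp only: smult_diff_right diff_self)
      then have "smult c' f0 - P * Q' = 0" using c'0(2) smult_eq_0_iff by blast
      then have "smult c' f0 = P * Q'" by (simp only: right_minus_eq)
      then have "S c'" using c'0 by (auto simp: S_def)
      then have "degree c \<le> degree c'" by (rule c(2))
      then show False using c' c'0 p(3) by (simp add: degree_mult_eq)
    qed
  qed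
  \<comment> \<open>Since \<open>f0\<close> is monic, a constant \<open>c\<close> leaves only a
    constant leading coefficient for \<open>P\<close>, which can be inverted.\<close>
  moreover have "c = lead_coeff P * lead_coeff Q"
    using arg_cong[OF Q, of lead_coeff] by (simp only: lead_coeff_mult lead_coeff_smult f0(1) mult_1_right)
  moreover have "c \<noteq> 0" using c(1) by (simp add: S_def)
  ultimately have "degree (lead_coeff P) = 0" by (auto simp: degree_mult_eq)
  then obtain a where a: "lead_coeff P = [:a:]" by (rule degree_eq_zeroE)
  have a0: "a \<noteq> 0" using a P0 by auto
  define f where "f = smult [:inverse a:] P"
  have f: "lead_coeff f = 1" "curve_eval u v f = 0" "degree f = m" using a a0 P(1,2)
    by (auto simp: f_def lead_coeff_smult curve_eval_smult R_def one_pCons)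
  have "f dvd Q" if "curve_eval u v Q = 0" for Q
  proof -
    obtain A B where AB: "Q = f * A + B" "B = 0 \<or> degree B < degree f" using divide_monic[OF f(1)] by blast
    have "curve_eval u v B = 0" using that f(2) AB(1) by (simp add: curve_eval.hom_add curve_eval.hom_mult)
    then have "B = 0" using AB(2) m(2)[of B] f(3) unfolding R_def by (metis not_le)
    then show ?thesis using AB(1) by simp
  qed
  then show ?thesis using f by blast
qed

text \<open>The variable of the Laurent series is \<open>1/t\<close>, so that degrees become negated subdegrees.\<close>

definition laurent :: "'k::field poly \<Rightarrow> 'k fls" where
  "laurent p = poly (map_poly fls_const p) fls_X_inv"

lemma laurent_pCons: "laurent (pCons a p) = fls_const a + fls_X_inv * laurent p"
  by (cases "a = 0 \<and> p = 0") (auto simp: laurent_def map_poly_pCons)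

lemma comm_ring_hom_fls_const: "comm_ring_hom (fls_const :: 'k::field \<Rightarrow> 'k fls)"
  by unfold_locales (auto simp: fls_plus_const)

lemma comm_ring_hom_laurent: "comm_ring_hom (laurent :: 'k::field poly \<Rightarrow> 'k fls)"
proof -
  interpret comm_ring_hom "fls_const :: 'k \<Rightarrow> 'k fls" by (rule comm_ring_hom_fls_const)
  interpret m: map_poly_comm_ring_hom "fls_const :: 'k \<Rightarrow> 'k fls" ..
  show ?thesis by unfold_locales (auto simp: laurent_def m.hom_add m.hom_mult)
qed

interpretation laurent: comm_ring_hom laurent by (rule comm_ring_hom_laurent)

lemma laurent_degree: "p \<noteq> 0 \<Longrightarrow> laurent p \<noteq> 0 \<and> fls_subdegree (laurent p) = - int (degree p)"
proof (induction p)
  case (pCons a p)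
  show ?case
  proof (cases "p = 0")
    case True
    then show ?thesis using pCons by (simp add: laurent_pCons)
  next
    case False
    then have IH: "laurent p \<noteq> 0" "fls_subdegree (laurent p) = - int (degree p)" using pCons by auto
    then have s: "fls_subdegree (fls_X_inv * laurent p) = - int (Suc (degree p))"
      by (simp add: fls_subdegree_mult_fls_X_inv)
    have nz: "fls_X_inv * laurent p \<noteq> 0" using IH by simp
    show ?thesis
    proof (cases "a = 0")
      case True
      then show ?thesis using s nz False by (simp add: laurent_pCons)
    next
      case a: False
      have "fls_subdegree (fls_X_inv * laurent p + fls_const a) = - int (Suc (degree p))"
        using s nz by (subst fls_subdegree_add_eq1) auto
      then show ?thesis using False by (auto simp: laurent_pCons add.commute)
    qed
  qed
qed simp

lemma laurent_eq_0_iff [simp]: "laurent p = 0 \<longleftrightarrow> p = 0"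
  using laurent_degree[of p] by auto

text \<open>One polynomial for each degree that occurs suffices, because subtracting a multiple of
  it lowers the degree. So the number of possible degrees bounds the dimension.\<close>

lemma subspace_spanning_set:
  fixes W :: "'k::field poly set"
  assumes add: "\<And>p q. p \<in> W \<Longrightarrow> q \<in> W \<Longrightarrow> p + q \<in> W" and smult: "\<And>c p. p \<in> W \<Longrightarrow> smult c p \<in> W"
    and degs: "\<And>p. p \<in> W \<Longrightarrow> p \<noteq> 0 \<Longrightarrow> degree p \<in> \<Delta>" and fin: "finite \<Delta>"
  shows "\<exists>C. finite C \<and> card C \<le> card \<Delta> \<and> W \<subseteq> module.span smult C"
proof -
  interpret vector_space "smult :: 'k \<Rightarrow> 'k poly \<Rightarrow> 'k poly"
    by unfold_locales (auto simp: smult_add_left smult_add_right)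
  define s where "s = (\<lambda>d. SOME p. p \<in> W \<and> p \<noteq> 0 \<and> degree p = d)"
  have s: "s (degree p) \<in> W \<and> s (degree p) \<noteq> 0 \<and> degree (s (degree p)) = degree p"
    if "p \<in> W" "p \<noteq> 0" for p
    unfolding s_def by (rule someI[of _ p]) (use that in auto)
  have "p \<in> span (s ` \<Delta>)" if "p \<in> W" for p
    using that
  proof (induction "degree p" arbitrary: p rule: less_induct)
    case less
    show ?case
    proof (cases "p = 0")
      case False
      let ?s = "s (degree p)"
      note sp = s[OF less.prems False]
      have ls: "lead_coeff ?s \<noteq> 0" using s[OF less.prems False] leading_coeff_0_iff by blast
      define c where "c = lead_coeff p / lead_coeff ?s"
      have sspan: "smult c ?s \<in> span (s ` \<Delta>)"
        using degs[OF less.prems False] by (intro span_scale span_base) auto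
      have "p + smult (- c) ?s \<in> span (s ` \<Delta>)"
      proof (cases "degree p = 0")
        case True
        obtain a where a: "p = [:a:]" using True by (rule degree_eq_zeroE)
        obtain b where b: "?s = [:b:]" using sp True by (metis degree_eq_zeroE)
        have "p + smult (- c) ?s = 0" using a b sp by (simp add: c_def)
        then show ?thesis by (simp add: span_zero)
      next
        case False
        have "degree (p - smult c ?s) < degree p"
          using sp ls False by (intro degree_diff_lead_less) (auto simp: c_def)
        moreover have "p + smult (- c) ?s \<in> W" using sp less.prems by (intro add smult) auto
        ultimately show ?thesis by (intro less.hyps) simp
      qed
      from span_add[OF this sspan] show ?thesis by simp
    qed (simp add: span_zero)
  qed
  moreover have "card (s ` \<Delta>) \<le> card \<Delta>" using fin by (rule card_image_le)
  ultimately show ?thesis using fin by (intro exI[of _ "s ` \<Delta>"]) auto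
qed

text \<open>The monomials \<open>u\<^sup>i v\<^sup>j\<close> with \<open>i \<le> M\<close>, \<open>j \<le> N\<close> would be too many independent polynomials for
  the available degrees if those were all multiples of \<open>D\<close>.\<close>

lemma degree_not_multiple_exists:
  fixes u v :: "'k::field poly"
  assumes "degree u > 0" "N * D = degree u"
    and inj: "\<And>P. P \<noteq> 0 \<Longrightarrow> degree P \<le> N \<Longrightarrow> curve_eval u v P \<noteq> 0"
  shows "\<exists>P. P \<noteq> 0 \<and> degree P \<le> N \<and> \<not> D dvd degree (curve_eval u v P)"
proof (rule ccontr)
  assume "\<not> ?thesis"
  then have dv: "\<And>P. P \<noteq> 0 \<Longrightarrow> degree P \<le> N \<Longrightarrow> D dvd degree (curve_eval u v P)" by blast
  interpret vector_space "smult :: 'k \<Rightarrow> 'k poly \<Rightarrow> 'k poly"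
    by unfold_locales (auto simp: smult_add_left smult_add_right)
  have D: "D > 0" using assms by (cases D) auto
  \<comment> \<open>With this \<open>M\<close> the degrees are at most
    \<open>(M * N + M) * D\<close>. That leaves \<open>M * N + M + 1\<close> multiples of
    \<open>D\<close> for \<open>(M + 1) * (N + 1)\<close> monomials, too few as
    \<open>N > 0\<close>.\<close>
  define M where "M = N * degree v"
  define WP where "WP = {P :: 'k poly poly. degree P \<le> N \<and> (\<forall>j. degree (coeff P j) \<le> M)}"
  define W where "W = curve_eval u v ` WP"
  define \<Delta> where "\<Delta> = (\<lambda>k. k * D) ` {..M * N + M}"
  have WP_add: "P + Q \<in> WP" if "P \<in> WP" "Q \<in> WP" for P Q
    using that by (auto simp: WP_def intro: degree_add_le)
  have WP_smult: "smult [:c:] P \<in> WP" if "P \<in> WP" for c P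
    using that by (auto simp: WP_def intro: order_trans[OF degree_smult_le])
  have WP_sum: "sum f I \<in> WP" if "\<And>i. i \<in> I \<Longrightarrow> f i \<in> WP" for f and I :: "(nat \<times> nat) set"
    using that
  proof (induction I rule: infinite_finite_induct)
    case (insert x F)
    then show ?case by (simp add: WP_add)
  qed (auto simp: WP_def)
  have "\<exists>C. finite C \<and> card C \<le> card \<Delta> \<and> W \<subseteq> module.span smult C"
  proof (rule subspace_spanning_set)
    show "p + q \<in> W" if "p \<in> W" "q \<in> W" for p q
      using that by (auto simp: W_def curve_eval.hom_add[symmetric] intro!: imageI WP_add)
    show "smult c p \<in> W" if "p \<in> W" for c p
      using that WP_smult by (auto simp: W_def image_iff curve_eval_smult intro!: bexI[of _ "smult [:c:] _"])
    show "degree p \<in> \<Delta>" if pW: "p \<in> W" "p \<noteq> 0" for p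
    proof -
      obtain P where P: "p = curve_eval u v P" "degree P \<le> N" "\<And>j. degree (coeff P j) \<le> M"
        using pW(1) unfolding W_def WP_def by blast
      have "P \<noteq> 0" using P(1) pW(2) by auto
      then obtain k where k: "degree p = D * k" using dv P by blast
      have "curve_eval u v P = (\<Sum>j\<le>degree P. (coeff P j \<circ>\<^sub>p u) * v ^ j)"
        using arg_cong[OF poly_as_sum_of_monoms[of P], of "curve_eval u v"] by (simp add: curve_eval.hom_sum curve_eval_monom)
      moreover have "degree ((coeff P j \<circ>\<^sub>p u) * v ^ j) \<le> M * degree u + N * degree v" if "j \<le> degree P" for j
      proof -
        have "degree ((coeff P j \<circ>\<^sub>p u) * v ^ j) \<le> degree (coeff P j \<circ>\<^sub>p u) + degree (v ^ j)"
          by (rule degree_mult_le)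
        also have "degree (coeff P j \<circ>\<^sub>p u) \<le> M * degree u"
          using P(3)[of j] by (simp add: degree_pcompose)
        also have "degree (v ^ j) \<le> N * degree v"
        proof (rule order_trans)
          show "degree (v ^ j) \<le> j * degree v" using degree_power_le[of v j] by (simp add: mult.commute)
          show "j * degree v \<le> N * degree v" using P(2) that by (intro mult_le_mono1) simp
        qed
        finally show ?thesis by simp
      qed
      ultimately have "degree p \<le> M * degree u + N * degree v"
        unfolding P(1) by (auto intro: degree_sum_le)
      also have "\<dots> \<le> (M * N + M) * D"
        using D by (simp add: assms(2)[symmetric] M_def algebra_simps)
      finally have "k \<le> M * N + M" using k D by (simp add: mult.commute[of D])
      then show ?thesis using k by (auto simp: \<Delta>_def mult.commute)
    qed
    show "finite \<Delta>" by (simp add: \<Delta>_def)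
  qed
  then obtain C where C: "finite C" "card C \<le> card \<Delta>" "W \<subseteq> span C" by blast
  define b where "b = (\<lambda>(i, j). curve_eval u v (monom (monom 1 i) j))"
  define I where "I = {..M} \<times> {..N}"
  have bP: "monom (monom c i) j \<in> WP" if "(i, j) \<in> I" for i j c
  proof -
    have "degree (monom c i) \<le> M" using that degree_monom_le[of c i] by (auto simp: I_def)
    moreover have "degree (monom (monom c i) j) \<le> N"
      using that degree_monom_le[of "monom c i" j] by (auto simp: I_def)
    ultimately show ?thesis by (auto simp: WP_def coeff_monom)
  qed
  have b_smult: "curve_eval u v (monom (monom c (fst x)) (snd x)) = smult c (b x)" for c x
  proof -
    have "monom c (fst x) = smult c (monom 1 (fst x))" by (simp add: smult_monom)
    then show ?thesis by (simp add: b_def curve_eval_monom pcompose_smult case_prod_beta)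
  qed
  have zero: "c x = 0" if "T \<subseteq> I" "x \<in> T" "(\<Sum>x\<in>T. smult (c x) (b x)) = 0" for c T x
  proof -
    define P where "P = (\<Sum>x\<in>T. monom (monom (c x) (fst x)) (snd x))"
    have fT: "finite T" using that(1) by (rule finite_subset) (simp add: I_def)
    have "curve_eval u v P = (\<Sum>x\<in>T. smult (c x) (b x))"
      unfolding P_def by (simp add: curve_eval.hom_sum b_smult)
    moreover have "P \<in> WP" unfolding P_def using that(1) bP[of "fst _" "snd _"] by (intro WP_sum) auto
    ultimately have "P = 0" using inj[of P] that(3) by (auto simp: WP_def)
    then have "coeff (coeff P (snd x)) (fst x) = 0" by simp
    moreover have "coeff (coeff P (snd x)) (fst x) = (\<Sum>y\<in>T. if y = x then c y else 0)"
      unfolding P_def coeff_sum by (intro sum.cong) (auto simp: coeff_monom prod_eq_iff)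
    ultimately show ?thesis using fT that(2) by simp
  qed
  have inj: "inj_on b I"
  proof (rule inj_onI)
    fix x y assume xy: "x \<in> I" "y \<in> I" "b x = b y"
    show "x = y"
    proof (rule ccontr)
      assume "x \<noteq> y"
      then have "(\<Sum>z\<in>{x, y}. smult (if z = x then 1 else -1) (b z)) = 0" using xy(3) by simp
      from zero[OF _ _ this, of x] xy show False by simp
    qed
  qed
  have "independent (b ` I)"
    unfolding dependent_explicit
  proof (safe, goal_cases)
    case (1 t c w)
    obtain T where T: "T \<subseteq> I" "t = b ` T" using 1(2) by (metis subset_imageE)
    have "(\<Sum>x\<in>T. smult (c (b x)) (b x)) = 0"
      using 1(3) unfolding T(2) by (subst (asm) sum.reindex) (use inj T(1) in \<open>auto intro: inj_on_subset\<close>)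
    then show ?case using zero[OF T(1), of _ "\<lambda>x. c (b x)"] 1 T(2) by auto
  qed
  moreover have "b ` I \<subseteq> span C" using bP C(3) by (force simp: b_def W_def)
  ultimately have "card (b ` I) \<le> card C" using independent_span_bound[OF C(1)] by blast
  then have "card I \<le> card \<Delta>" using C(2) card_image[OF inj] by simp
  also have "card \<Delta> \<le> M * N + M + 1" using card_image_le[of "{..M * N + M}" "\<lambda>k. k * D"] by (simp add: \<Delta>_def)
  also have "card I = (M + 1) * (N + 1)" by (simp add: I_def)
  finally have "N = 0" by simp
  then show False using assms(1,2) by simp
qed

text \<open>With \<open>n = a * d\<close>, \<open>m = b * d\<close> and d the gcd, the hypothesis
  says \<open>(a - 1) * b < a\<close>, which fails once a and b are both at least 2.\<close>

lemma coprime_part_cases: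
  fixes n m :: nat
  assumes "n > 0" "m > 0" "(int n div gcd (int n) (int m) - 1) * int m \<le> int n - 1"
  shows "n dvd m \<or> m dvd n"
proof -
  define d where "d = gcd n m"
  obtain a b where ab: "n = a * d" "m = b * d" by (metis d_def gcd_dvd1 gcd_dvd2 dvd_def mult.commute)
  have pos: "a > 0" "b > 0" "d > 0" using assms(1,2) ab by auto
  have "int n div gcd (int n) (int m) = int a"
    using pos by (simp add: gcd_int_int_eq flip: d_def) (simp add: ab(1))
  then have dg_le: "(int a - 1) * (int b * int d) \<le> int a * int d - 1" using assms(3) ab by simp
  have "a = 1 \<or> b = 1"
  proof (rule ccontr)
    assume "\<not> ?thesis"
    then have 2: "a \<ge> 2" "b \<ge> 2" using pos by auto
    have "int a \<le> (int a - 1) * 2" using 2 by simp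
    also have "\<dots> \<le> (int a - 1) * int b" using 2 by (intro mult_left_mono) auto
    finally have "int a * int d \<le> (int a - 1) * int b * int d" by (intro mult_right_mono) auto
    then show False using dg_le by (simp add: mult.assoc)
  qed
  then show ?thesis using ab by auto
qed

theorem degree_dvd_of_smooth:
  fixes u v :: "'k::field_char_0 poly"
  assumes du: "degree u > 0" and dv: "degree v > 0"
    and f: "lead_coeff f = 1" "curve_eval u v f = 0" and min: "\<And>P. curve_eval u v P = 0 \<Longrightarrow> f dvd P"
    and dvd: "curve_eval u v (pderiv f) dvd pderiv u"
  shows "degree u dvd degree v \<or> degree v dvd degree u"
proof (cases "degree u dvd degree v")
  case ndvd: False
  \<comment> \<open>The map \<open>e\<close> identifies the coefficient ring \<open>K[X]\<close>
    with \<open>K[u]\<close> inside the Laurent series; below, \<open>A\<close> is its image and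
    \<open>F\<close> the field of fractions of that image.\<close>
  define e where "e = (\<lambda>p :: 'k poly. laurent (p \<circ>\<^sub>p u))"
  have e_hom: "comm_ring_hom e"
    by unfold_locales (auto simp: e_def pcompose_add pcompose_mult pcompose_1 laurent.hom_add laurent.hom_mult)
  interpret e: comm_ring_hom e by (rule e_hom)
  have e_0 [simp]: "e p = 0 \<longleftrightarrow> p = 0" for p
    using du by (simp add: e_def pcompose_eq_0_iff)
  define dg where "dg = (\<lambda>z :: 'k fls. - fls_subdegree z)"
  have dg_emb: "p \<noteq> 0 \<Longrightarrow> dg (laurent p) = int (degree p)" for p
    using laurent_degree[of p] by (simp add: dg_def)
  have dg_e: "p \<noteq> 0 \<Longrightarrow> dg (e p) = int (degree p) * int (degree u)" for p
    using dg_emb[of "p \<circ>\<^sub>p u"] e_0[of p] by (simp add: e_def degree_pcompose)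
  define V where "V = laurent v"
  define cP where "cP = map_poly e"
  define A where "A = range e"
  define F where "F = {e p / e q |p q. q \<noteq> 0}"
  have ev: "poly (cP P) V = laurent (curve_eval u v P)" for P
  proof -
    have "cP P = map_poly laurent (map_poly (\<lambda>p. p \<circ>\<^sub>p u) P)"
      by (simp add: cP_def e_def map_poly_map_poly o_def)
    then show ?thesis by (simp add: V_def curve_eval_def)
  qed
  have coeff_cP: "coeff (cP P) i = e (coeff P i)" for P i by (simp add: cP_def coeff_map_poly)
  have deg_cP: "degree (cP P) = degree P" for P by (simp add: cP_def degree_map_poly)
  have cP_0 [simp]: "cP P = 0 \<longleftrightarrow> P = 0" for P
    by (simp add: poly_eq_iff coeff_cP)
  have F_I: "q \<noteq> 0 \<Longrightarrow> e p / e q \<in> F" for p q by (auto simp: F_def)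
  have eF: "e p \<in> F" for p using F_I[of 1 p] by simp
  interpret vf: valued_field dg F
  proof
    fix a b :: "'k fls" assume "a \<noteq> 0" "b \<noteq> 0"
    then show "dg (a * b) = dg a + dg b" by (simp add: dg_def)
    assume "a + b \<noteq> 0"
    then show "dg (a + b) \<le> max (dg a) (dg b)"
      using fls_plus_subdegree[of a b] by (auto simp: dg_def min_def max_def split: if_splits)
  next
    show "0 \<in> F" "1 \<in> F" using eF[of 0] eF[of 1] by simp_all
    fix a assume "a \<in> F"
    then obtain p q where a: "a = e p / e q" "q \<noteq> 0" by (auto simp: F_def)
    show "- a \<in> F" using F_I[OF a(2), of "- p"] a by (simp add: e.hom_uminus)
    show "inverse a \<in> F" using F_I[of p q] eF[of 0] a by (cases "p = 0") (auto simp: divide_inverse mult.commute)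
    fix b assume "b \<in> F"
    then obtain p' q' where b: "b = e p' / e q'" "q' \<noteq> 0" by (auto simp: F_def)
    show "a * b \<in> F" using F_I[of "q * q'" "p * p'"] a b by (simp add: e.hom_mult)
    show "a + b \<in> F" using F_I[of "q * q'" "p * q' + p' * q"] a b
      by (simp add: e.hom_mult e.hom_add add_frac_eq)
  qed
  have cP_PF: "cP P \<in> vf.polyF" for P using eF by (simp add: vf.polyF_def coeff_cP)
  \<comment> \<open>Clearing denominators turns a polynomial over \<open>K(u)\<close> into one over
    \<open>K[X]\<close>, to which the minimality of \<open>f\<close> as a relation applies.\<close>
  have clear: "\<exists>q P. q \<noteq> 0 \<and> smult (e q) G = cP P" if "G \<in> vf.polyF" for G
    using that
  proof (induction G)
    case 0
    have "smult (e 1) 0 = cP 0" by (simp add: cP_def)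
    then show ?case by (metis zero_neq_one)
  next
    case (pCons a G)
    have "a \<in> F" "G \<in> vf.polyF"
      using pCons.prems by (auto simp: vf.polyF_def coeff_pCons dest: spec[of _ 0] spec[of _ "Suc _"])
    then obtain p r q P where *: "a = e p / e r" "r \<noteq> 0" "q \<noteq> 0" "smult (e q) G = cP P"
      using pCons.IH by (auto simp: F_def)
    have "smult (e (q * r)) (pCons a G) = cP (pCons (p * q) (smult r P))"
    proof (rule poly_eqI)
      fix i
      have "e q * coeff G j = e (coeff P j)" for j
        using arg_cong[OF *(4), of "\<lambda>p. coeff p j"] by (simp add: coeff_cP)
      then show "coeff (smult (e (q * r)) (pCons a G)) i = coeff (cP (pCons (p * q) (smult r P))) i"
        using *(1,2) by (cases i) (auto simp: coeff_cP e.hom_mult mult_ac)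
    qed
    then show ?case using *(2,3) by (metis mult_eq_0_iff)
  qed
  have f0: "f \<noteq> 0" using f by auto
  have f_minimal: "curve_eval u v P \<noteq> 0" if "P \<noteq> 0" "degree P < degree f" for P
    using min[of P] that dvd_imp_degree_le[of f P] by auto
  have dgf: "degree f > 0"
  proof (rule ccontr)
    assume "\<not> degree f > 0"
    then have "f = 1" using f(1) monic_degree_0[of f] by simp
    then show False using f(2) by simp
  qed
  interpret T: valued_tower dg F V "int (degree u)" "cP f" A
  proof
    show "int (degree u) dvd dg a" if "a \<in> F" "a \<noteq> 0" for a
    proof -
      obtain p q where pq: "a = e p / e q" "q \<noteq> 0" using \<open>a \<in> F\<close> by (auto simp: F_def)
      then have "a * e q = e p" "p \<noteq> 0" using that(2) by auto
      then have "dg a + dg (e q) = dg (e p)" using vf.dg_mult[of a "e q"] that(2) pq(2) by simp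
      then have "dg a = (int (degree p) - int (degree q)) * int (degree u)"
        using dg_e pq(2) \<open>p \<noteq> 0\<close> by (simp add: algebra_simps)
      then show ?thesis by simp
    qed
    show "0 < int (degree u)" using du by simp
    show "cP f \<in> vf.polyF" by (rule cP_PF)
    show "lead_coeff (cP f) = 1" using f(1) by (simp add: coeff_cP deg_cP)
    show "poly (cP f) V = 0" by (simp add: ev f(2))
    show "poly G V \<noteq> 0" if G: "G \<in> vf.polyF" "G \<noteq> 0" "degree G < degree (cP f)" for G
    proof -
      obtain q P where qP: "q \<noteq> 0" "smult (e q) G = cP P" using clear[OF G(1)] by blast
      have "degree P = degree G" using qP deg_cP[of P] by (metis degree_smult_eq e_0)
      moreover have "P \<noteq> 0" using qP G(2) cP_0[of P] by (metis e_0 smult_eq_0_iff)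
      ultimately have "laurent (curve_eval u v P) \<noteq> 0" using f_minimal G(3) deg_cP by simp
      then have "poly (smult (e q) G) V \<noteq> 0" using qP ev by simp
      then show ?thesis by auto
    qed
    \<comment> \<open>Below the degree of \<open>f\<close> there are no relations, so the monomials
      in the dimension count are independent.\<close>
    show "\<exists>G\<in>vf.polyF. G \<noteq> 0 \<and> degree G \<le> N \<and> \<not> D dvd dg (poly G V)"
      if D: "D > 0" "int N * D = int (degree u)" "N < degree (cP f)" for D N
    proof -
      have "N * nat D = degree u" using D by (metis int_nat_eq less_imp_le of_nat_eq_iff of_nat_mult)
      from degree_not_multiple_exists[OF du this, of v] f_minimal D(3) deg_cP
      obtain P where P: "P \<noteq> 0" "degree P \<le> N" "\<not> nat D dvd degree (curve_eval u v P)" by fastforce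
      have nz: "curve_eval u v P \<noteq> 0" using f_minimal[OF P(1)] P(2) D(3) deg_cP[of f] by simp
      have "\<not> D dvd dg (poly (cP P) V)"
        using P(3) D(1) dg_emb[OF nz] by (simp add: ev) (metis int_dvd_int_iff int_nat_eq less_imp_le)
      then show ?thesis using P deg_cP[of P] cP_PF[of P] by (intro bexI[of _ "cP P"]) auto
    qed
    show "1 \<in> A" unfolding A_def by (metis e.hom_one rangeI)
    show "a + b \<in> A" "a * b \<in> A" if "a \<in> A" "b \<in> A" for a b
      using that by (auto simp: A_def simp flip: e.hom_add e.hom_mult)
    show "- a \<in> A" if "a \<in> A" for a using that by (auto simp: A_def simp flip: e.hom_uminus)
    show "a \<in> A" if "of_nat k * a \<in> A" "k > 0" for k a
    proof -
      obtain p where p: "of_nat k * a = e p" using \<open>of_nat k * a \<in> A\<close> by (auto simp: A_def)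
      have "of_nat k * e (smult (inverse (of_nat k)) p) = e (of_nat k * smult (inverse (of_nat k)) p)"
        by (simp only: e.hom_mult e.hom_of_nat)
      also have "of_nat k * smult (inverse (of_nat k)) p = p"
        using \<open>k > 0\<close> by (simp add: of_nat_poly)
      finally have "of_nat k * e (smult (inverse (of_nat k)) p) = of_nat k * a" using p by simp
      then have "a = e (smult (inverse (of_nat k)) p)" using \<open>k > 0\<close> by simp
      then show ?thesis by (simp add: A_def)
    qed
    show "of_nat k \<noteq> (0 :: 'k fls)" if "k > 0" for k using that by simp
    show "coeff (cP f) i \<in> A" for i by (simp add: coeff_cP A_def)
    \<comment> \<open>With coefficients in \<open>K[u]\<close> the value is a polynomial in
      t.\<close>
    show "0 \<le> dg (poly G V)" if G: "\<And>i. coeff G i \<in> A" "poly G V \<noteq> 0" for G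
    proof -
      have "\<exists>p. poly G V = laurent p"
        using G(1)
      proof (induction G)
        case 0 then show ?case by (metis laurent.hom_zero poly_0)
      next
        case (pCons a G)
        obtain p where "poly G V = laurent p" using pCons.IH pCons.prems[of "Suc _"] by auto
        moreover obtain r where "a = laurent (r \<circ>\<^sub>p u)" using pCons.prems[of 0] by (auto simp: A_def e_def)
        ultimately have "poly (pCons a G) V = laurent (r \<circ>\<^sub>p u + v * p)"
          by (simp add: V_def laurent.hom_add laurent.hom_mult)
        then show ?case by blast
      qed
      then show ?thesis using G(2) dg_emb by force
    qed
  qed
  have dgV: "dg V = int (degree v)" using dg_emb[of v] dv by (force simp: V_def)
  \<comment> \<open>This constant makes the derivative of \<open>f\<close> monic and, being a
    nonzero scalar, does not change the degree of its value.\<close>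
  define c where "c = e [:inverse (of_nat (degree f)):]"
  have c: "c \<in> F" "c \<noteq> 0" "dg c = 0" "c * e (of_nat (degree f)) = 1"
  proof -
    show "c \<in> F" "c \<noteq> 0" using eF dgf by (auto simp: c_def)
    show "dg c = 0" using dg_e[of "[:inverse (of_nat (degree f)):]"] dgf by (simp add: c_def)
    have "c * e (of_nat (degree f)) = e ([:inverse (of_nat (degree f)):] * of_nat (degree f))"
      by (simp only: c_def e.hom_mult)
    also have "[:inverse (of_nat (degree f)):] * of_nat (degree f) = (1 :: 'k poly)"
      using dgf by (simp add: of_nat_poly one_pCons)
    finally show "c * e (of_nat (degree f)) = 1" by simp
  qed
  have "pderiv u \<noteq> 0" using du by (simp add: pderiv_eq_0_iff)
  then have nz: "curve_eval u v (pderiv f) \<noteq> 0" using dvd by auto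
  define G where "G = smult c (cP (pderiv f))"
  have "(int (degree u) div gcd (int (degree u)) (dg V) - 1) * dg V \<le> dg (poly G V)"
  proof (rule T.monic_codegree_one_bound)
    show "V \<noteq> 0" using dv by (auto simp: V_def)
    show "\<not> int (degree u) dvd dg V" using ndvd by (simp add: dgV)
    show "G \<in> vf.polyF" unfolding G_def by (intro vf.polyF_smult c cP_PF)
    show dG: "degree G = degree (cP f) - 1" using c(2) by (simp add: G_def deg_cP degree_pderiv)
    have "coeff (pderiv f) (degree f - 1) = of_nat (degree f)"
      using dgf f(1) by (simp add: coeff_pderiv)
    then show "lead_coeff G = 1" using c(4) unfolding dG by (simp add: G_def deg_cP coeff_cP)
  qed
  also have "dg (poly G V) = int (degree (curve_eval u v (pderiv f)))"
    using vf.dg_mult[OF c(2), of "laurent (curve_eval u v (pderiv f))"] nz c(3) dg_emb[OF nz] by (simp add: G_def ev)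
  also have "\<dots> \<le> int (degree (pderiv u))"
    using dvd_imp_degree_le[OF dvd] \<open>pderiv u \<noteq> 0\<close> by simp
  also have "\<dots> = int (degree u) - 1" using du by (simp add: degree_pderiv)
  finally show ?thesis using coprime_part_cases[OF du dv] by (simp add: dgV)
qed simp

section \<open>Homomorphisms from the free algebra\<close>

lemma const_0 [simp]: "const 0 = 0" and const_1 [simp]: "const 1 = 1"
  by (simp_all add: const_def)

lemma const_add: "const (c + d) = const c + const d"
  by (simp add: const_def single_add)

lemma const_mult: "const (c * d) = const c * const d"
  by (simp add: const_def mult_single)

lemma const_uminus: "const (- c) = - const c"
  by (simp add: const_def single_uminus)

section \<open>Induction principles and the universal property\<close>

lemma additive_induct:
  assumes "\<And>w c. P (Poly_Mapping.single w c)" "\<And>f g. P f \<Longrightarrow> P g \<Longrightarrow> P (f + g)"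
  shows "P (f :: 'k::field free_alg)"
proof -
  have "P (\<Sum>w\<in>A. Poly_Mapping.single w (Poly_Mapping.lookup f w))" for A
    using assms(1)[of undefined 0] by (induction A rule: infinite_finite_induct) (auto intro: assms)
  moreover have "(\<Sum>w\<in>Poly_Mapping.keys f. Poly_Mapping.single w (Poly_Mapping.lookup f w)) = f"
    by (rule poly_mapping_eqI) (simp add: lookup_sum lookup_single when_def in_keys_iff)
  ultimately show ?thesis by metis
qed

lemma free_alg_induct [case_names const var_x var_y add mult]:
  assumes "\<And>c. P (const c)" "P var_x" "P var_y" "\<And>f g. P f \<Longrightarrow> P g \<Longrightarrow> P (f + g)"
    "\<And>f g. P f \<Longrightarrow> P g \<Longrightarrow> P (f * g)"
  shows "P (f :: 'k::field free_alg)"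
proof (rule additive_induct[of P])
  fix w :: word and c :: 'k
  obtain ls where "w = Word ls" by (cases w)
  moreover have "P (Poly_Mapping.single (Word ls) c)"
  proof (induction ls)
    case Nil
    then show ?case using assms(1)[of c] by (simp add: const_def zero_word_def)
  next
    case (Cons l ls)
    have "Poly_Mapping.single (Word (l # ls)) c = Poly_Mapping.single (Word [l]) 1 * Poly_Mapping.single (Word ls) c"
      by (simp add: mult_single plus_word_def)
    moreover have "P (Poly_Mapping.single (Word [l]) 1)"
      using assms(2,3) by (cases l) (simp_all add: var_x_def var_y_def)
    ultimately show ?case using Cons assms(5) by metis
  qed
  ultimately show "P (Poly_Mapping.single w c)" by simp
qed (use assms(4) in auto)

text \<open>The pairs of words with a given concatenation are the cuts of that word into prefix and
  suffix, so the convolution is a finite sum over cutting positions.\<close>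

lemma lookup_mult_split:
  "Poly_Mapping.lookup (f * g :: 'k::field free_alg) (Word ls) =
    (\<Sum>i\<le>length ls. Poly_Mapping.lookup f (Word (take i ls)) * Poly_Mapping.lookup g (Word (drop i ls)))"
proof (induction f rule: additive_induct)
  case (1 w c)
  obtain us where w: "w = Word us" by (cases w)
  show ?case
  proof (induction g rule: additive_induct)
    case (1 w' d)
    obtain vs where w': "w' = Word vs" by (cases w')
    have "Poly_Mapping.lookup (Poly_Mapping.single w c) (Word (take i ls)) * Poly_Mapping.lookup (Poly_Mapping.single w' d) (Word (drop i ls))
      = (if i = length us then (if us @ vs = ls then c * d else 0) else 0)" if "i \<le> length ls" for i
    proof -
      have "(us = take i ls \<and> vs = drop i ls) \<longleftrightarrow> (i = length us \<and> us @ vs = ls)"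
        using that by auto
      moreover have "Poly_Mapping.lookup (Poly_Mapping.single w c) (Word (take i ls)) *
          Poly_Mapping.lookup (Poly_Mapping.single w' d) (Word (drop i ls))
        = (if us = take i ls \<and> vs = drop i ls then c * d else 0)"
        unfolding w w' lookup_single when_def by simp
      ultimately show ?thesis by (simp only:) simp
    qed
    then have "(\<Sum>i\<le>length ls. Poly_Mapping.lookup (Poly_Mapping.single w c) (Word (take i ls)) * Poly_Mapping.lookup (Poly_Mapping.single w' d) (Word (drop i ls)))
      = (\<Sum>i\<le>length ls. if i = length us then (if us @ vs = ls then c * d else 0) else 0)"
      by (intro sum.cong) auto
    also have "\<dots> = (if us @ vs = ls then c * d else 0)" by auto
    finally show ?case by (simp add: mult_single lookup_single when_def w w' plus_word_def)
  next
    case (2 f g)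
    then show ?case by (simp add: distrib_left lookup_add sum.distrib)
  qed
next
  case (2 f g)
  then show ?case by (simp add: distrib_right lookup_add sum.distrib)
qed

definition word_val :: "(letter \<Rightarrow> 'b::monoid_mult) \<Rightarrow> word \<Rightarrow> 'b" where
  "word_val val w = prod_list (map val (letters w))"

lemma word_val_0 [simp]: "word_val val 0 = 1" and word_val_add: "word_val val (u + w) = word_val val u * word_val val w"
  by (simp_all add: word_val_def zero_word_def plus_word_def)

definition fa_eval :: "('k::field \<Rightarrow> 'b::ring_1) \<Rightarrow> (letter \<Rightarrow> 'b) \<Rightarrow> 'k free_alg \<Rightarrow> 'b" where
  "fa_eval h val f = (\<Sum>w\<in>Poly_Mapping.keys f. h (Poly_Mapping.lookup f w) * word_val val w)"

text \<open>Centrality of the scalars allows evaluation at noncommuting values; endomorphisms,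
  restriction to a line and abelianization are thus instances of one construction.\<close>

locale central_hom =
  fixes h :: "'k::field \<Rightarrow> 'b::ring_1"
  assumes h_1: "h 1 = 1" and h_add: "h (c + d) = h c + h d" and h_mult: "h (c * d) = h c * h d"
    and h_central: "h c * z = z * h c"
begin

lemma h_0: "h 0 = 0" using h_add[of 0 0] by simp

lemma fa_eval_add: "fa_eval h val (f + g) = fa_eval h val f + fa_eval h val g"
  unfolding fa_eval_def by (rule setsum_keys_plus_distrib) (auto simp: h_0 h_add algebra_simps)

lemma fa_eval_single: "fa_eval h val (Poly_Mapping.single w c) = h c * word_val val w"
  by (simp add: fa_eval_def h_0)

lemma fa_eval_mult: "fa_eval h val (f * g) = fa_eval h val f * fa_eval h val g"
proof (induction f rule: additive_induct)
  case (1 w c)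
  show ?case
  proof (induction g rule: additive_induct)
    case (1 w' d)
    have "h c * h d * (word_val val w * word_val val w') = h c * (h d * word_val val w) * word_val val w'"
      by (simp add: mult.assoc)
    also have "\<dots> = h c * word_val val w * (h d * word_val val w')"
      by (simp only: h_central[of d "word_val val w"] mult.assoc)
    finally show ?case by (simp add: mult_single fa_eval_single word_val_add h_mult)
  qed (simp add: distrib_left fa_eval_add)
qed (simp add: distrib_right fa_eval_add)

lemma fa_eval_const: "fa_eval h val (const c) = h c"
  by (simp add: const_def fa_eval_single)

lemma fa_eval_x: "fa_eval h val var_x = val X" and fa_eval_y: "fa_eval h val var_y = val Y"
  by (simp_all add: var_x_def var_y_def fa_eval_single h_1 word_val_def)

end

lemma const_central: "const c * f = f * const (c :: 'k::field)"
proof (induction f rule: additive_induct)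
  case (1 w d)
  show ?case by (simp add: const_def mult_single mult.commute)
qed (simp add: distrib_left distrib_right)

interpretation endo_eval: central_hom "const :: 'k::field \<Rightarrow> 'k free_alg"
  by unfold_locales (simp_all only: const_1 const_add const_mult, rule const_central)

interpretation line_eval: central_hom "\<lambda>c :: 'k::field. [:c:]"
  by unfold_locales (simp_all add: one_pCons mult.commute)

interpretation abel_eval: central_hom "\<lambda>c :: 'k::field. [:[:c:]:]"
  by unfold_locales (simp_all add: one_pCons mult.commute)

section \<open>Endomorphisms and automorphisms given by substitution\<close>

definition subst :: "'k::field free_alg \<Rightarrow> 'k free_alg \<Rightarrow> 'k free_alg \<Rightarrow> 'k free_alg" where
  "subst a b = fa_eval const (case_letter a b)"

lemma subst_add: "subst a b (f + g) = subst a b f + subst a b g"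
  and subst_mult: "subst a b (f * g) = subst a b f * subst a b g"
  and subst_const [simp]: "subst a b (const c) = const c"
  and subst_x [simp]: "subst a b var_x = a" and subst_y [simp]: "subst a b var_y = b"
  by (simp_all add: subst_def endo_eval.fa_eval_add endo_eval.fa_eval_mult endo_eval.fa_eval_const endo_eval.fa_eval_x endo_eval.fa_eval_y)

lemma alg_endo_subst: "alg_endo (subst a b)"
  using subst_const[of a b 1] by (auto simp: alg_endo_def subst_add subst_mult scale_def)

lemma alg_endo_add: "alg_endo \<phi> \<Longrightarrow> \<phi> (f + g) = \<phi> f + \<phi> g"
  and alg_endo_mult: "alg_endo \<phi> \<Longrightarrow> \<phi> (f * g) = \<phi> f * \<phi> g"
  by (simp_all add: alg_endo_def)

lemma alg_endo_const: "alg_endo \<phi> \<Longrightarrow> \<phi> (const c) = const c"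
  unfolding alg_endo_def scale_def by (metis mult.right_neutral)

lemma alg_endo_0: "alg_endo \<phi> \<Longrightarrow> \<phi> 0 = 0"
  using alg_endo_const[of \<phi> 0] by simp

lemma alg_endo_diff: "alg_endo \<phi> \<Longrightarrow> \<phi> (f - g) = \<phi> f - \<phi> g"
  using alg_endo_add[of \<phi> "f - g" g] by (simp add: algebra_simps)

lemma alg_endo_power: "alg_endo \<phi> \<Longrightarrow> \<phi> (f ^ k) = \<phi> f ^ k"
  by (induction k) (auto simp: alg_endo_mult alg_endo_def)

lemma alg_endo_eqI:
  assumes "alg_endo \<phi>" "alg_endo \<psi>" "\<phi> var_x = \<psi> var_x" "\<phi> var_y = \<psi> var_y"
  shows "\<phi> = \<psi>"
proof
  fix f show "\<phi> f = \<psi> f"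
    by (induction f rule: free_alg_induct)
      (simp_all add: assms alg_endo_const alg_endo_add alg_endo_mult)
qed

lemma alg_endo_comp: "alg_endo \<phi> \<Longrightarrow> alg_endo \<psi> \<Longrightarrow> alg_endo (\<phi> \<circ> \<psi>)"
  by (simp add: alg_endo_def)

lemma alg_endo_id: "alg_endo id"
  by (simp add: alg_endo_def)

lemma alg_auto_comp: "alg_auto \<phi> \<Longrightarrow> alg_auto \<psi> \<Longrightarrow> alg_auto (\<phi> \<circ> \<psi>)"
  by (simp add: alg_auto_def alg_endo_comp bij_comp)

lemma alg_auto_inverse:
  assumes "alg_auto \<psi>"
  shows "\<exists>\<psi>'. alg_auto \<psi>' \<and> (\<forall>f. \<psi>' (\<psi> f) = f) \<and> (\<forall>f. \<psi> (\<psi>' f) = f)"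
proof (intro exI conjI allI)
  have b: "bij \<psi>" and e: "alg_endo \<psi>" using assms by (auto simp: alg_auto_def)
  show 1: "inv_into UNIV \<psi> (\<psi> f) = f" "\<psi> (inv_into UNIV \<psi> f) = f" for f
    using b by (auto simp: bij_is_inj bij_is_surj surj_f_inv_f)
  have "alg_endo (inv_into UNIV \<psi>)"
    unfolding alg_endo_def
  proof (intro conjI allI)
    show "inv_into UNIV \<psi> 1 = 1" using e 1(1)[of 1] by (simp add: alg_endo_def)
    show "inv_into UNIV \<psi> (f + g) = inv_into UNIV \<psi> f + inv_into UNIV \<psi> g" for f g
      using e 1(1)[of "inv_into UNIV \<psi> f + inv_into UNIV \<psi> g"] 1(2) by (simp add: alg_endo_def)
    show "inv_into UNIV \<psi> (f * g) = inv_into UNIV \<psi> f * inv_into UNIV \<psi> g" for f g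
      using e 1(1)[of "inv_into UNIV \<psi> f * inv_into UNIV \<psi> g"] 1(2) by (simp add: alg_endo_def)
    show "inv_into UNIV \<psi> (scale c f) = scale c (inv_into UNIV \<psi> f)" for c f
      using e 1(1)[of "scale c (inv_into UNIV \<psi> f)"] 1(2) by (simp add: alg_endo_def)
  qed
  then show "alg_auto (inv_into UNIV \<psi>)" using b by (simp add: alg_auto_def bij_imp_bij_inv)
qed

lemma alg_auto_subst:
  assumes "subst a b a' = var_x" "subst a b b' = var_y" "subst a' b' a = var_x" "subst a' b' b = var_y"
  shows "alg_auto (subst a b)"
proof -
  have "subst a b \<circ> subst a' b' = id" "subst a' b' \<circ> subst a b = id"
    using assms by (auto intro!: alg_endo_eqI alg_endo_comp alg_endo_subst alg_endo_id)
  then have "bij (subst a b)" by (metis o_bij)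
  then show ?thesis by (simp add: alg_auto_def alg_endo_subst)
qed

lemma alg_auto_swap: "alg_auto (subst var_y var_x)"
  by (rule alg_auto_subst[of _ _ var_y var_x]) simp_all

lemma alg_auto_translation: "alg_auto (subst (var_x + const c) (var_y + const d))"
  by (rule alg_auto_subst[of _ _ "var_x + const (- c)" "var_y + const (- d)"])
    (simp_all add: const_uminus subst_add alg_endo_diff[OF alg_endo_subst])

lemma alg_auto_elementary: "alg_auto (subst var_x (var_y + const c * var_x ^ k))"
  by (rule alg_auto_subst[of _ _ var_x "var_y + const (- c) * var_x ^ k"])
    (simp_all add: const_uminus subst_add subst_mult alg_endo_power[OF alg_endo_subst] alg_endo_diff[OF alg_endo_subst])

section \<open>Smooth curves and their straightening\<close>

definition curve_hom :: "('k::field free_alg \<Rightarrow> 'k poly) \<Rightarrow> bool" where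
  "curve_hom \<theta> \<longleftrightarrow> (\<forall>f g. \<theta> (f + g) = \<theta> f + \<theta> g) \<and> (\<forall>f g. \<theta> (f * g) = \<theta> f * \<theta> g) \<and> (\<forall>c. \<theta> (const c) = [:c:])"

lemma curve_hom_add: "curve_hom \<theta> \<Longrightarrow> \<theta> (f + g) = \<theta> f + \<theta> g"
  and curve_hom_mult: "curve_hom \<theta> \<Longrightarrow> \<theta> (f * g) = \<theta> f * \<theta> g"
  and curve_hom_const: "curve_hom \<theta> \<Longrightarrow> \<theta> (const c) = [:c:]"
  by (simp_all add: curve_hom_def)

lemma curve_hom_diff: "curve_hom \<theta> \<Longrightarrow> \<theta> (f - g) = \<theta> f - \<theta> g"
  using curve_hom_add[of \<theta> "f - g" g] by (simp add: algebra_simps)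

lemma curve_hom_power: "curve_hom \<theta> \<Longrightarrow> \<theta> (f ^ k) = \<theta> f ^ k"
  using curve_hom_const[of \<theta> 1] by (induction k) (auto simp: curve_hom_mult one_pCons)

lemma curve_hom_comp: "curve_hom \<theta> \<Longrightarrow> alg_endo \<psi> \<Longrightarrow> curve_hom (\<theta> \<circ> \<psi>)"
  by (simp add: curve_hom_def alg_endo_add alg_endo_mult alg_endo_const)

definition abel :: "'k::field free_alg \<Rightarrow> 'k poly poly" where
  "abel = fa_eval (\<lambda>c. [:[:c:]:]) (case_letter [:[:0, 1:]:] [:0, 1:])"

lemma abel_add: "abel (f + g) = abel f + abel g"
  unfolding abel_def by (rule abel_eval.fa_eval_add)

lemma abel_mult: "abel (f * g) = abel f * abel g"
  unfolding abel_def by (rule abel_eval.fa_eval_mult)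

lemma abel_const [simp]: "abel (const c) = [:[:c:]:]"
  unfolding abel_def by (rule abel_eval.fa_eval_const)

lemma abel_x [simp]: "abel var_x = [:[:0, 1:]:]" and abel_y [simp]: "abel var_y = [:0, 1:]"
  unfolding abel_def by (simp_all add: abel_eval.fa_eval_x abel_eval.fa_eval_y)

lemma abel_0: "abel 0 = 0"
  using abel_const[of 0] by simp

lemma abel_diff: "abel (f - g) = abel f - abel g"
  using abel_add[of "f - g" g] by (simp add: algebra_simps)

lemma abel_surj: "\<exists>f. abel f = P"
proof (induction P)
  case 0
  show ?case using abel_0 by blast
next
  case (pCons p P)
  then obtain g where g: "abel g = P" by blast
  have "\<exists>f. abel f = [:p:]"
  proof (induction p)
    case 0
    show ?case using abel_0 by (intro exI[of _ 0]) simp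
  next
    case (pCons a p)
    then obtain f where "abel f = [:p:]" by blast
    then have "abel (const a + var_x * f) = [:pCons a p:]" by (simp add: abel_add abel_mult)
    then show ?case by blast
  qed
  then obtain f where "abel f = [:p:]" by blast
  then have "abel (f + var_y * g) = pCons p P" using g by (simp add: abel_add abel_mult)
  then show ?case by blast
qed

text \<open>As \<open>K[t]\<close> is commutative, such a homomorphism factors through
  abelianization; this connects the free algebra with the equation of the curve.\<close>

lemma curve_hom_abel: "curve_hom \<theta> \<Longrightarrow> \<theta> f = curve_eval (\<theta> var_x) (\<theta> var_y) (abel f)"
  by (induction f rule: free_alg_induct)
    (simp_all add: curve_hom_def abel_add abel_mult curve_eval.hom_add curve_eval.hom_mult curve_eval_pCons pcompose_pCons)

text \<open>\<open>E\<close> is a derivation along \<open>\<theta>\<close> that is transversal to the curve; in this form smoothness is visibly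
  invariant under automorphisms of the free algebra.\<close>

definition smooth_curve :: "('k::field free_alg \<Rightarrow> 'k poly) \<Rightarrow> bool" where
  "smooth_curve \<theta> \<longleftrightarrow> (\<exists>E F. (\<forall>f g. E (f + g) = E f + E g) \<and>
     (\<forall>f g. E (f * g) = E f * \<theta> g + \<theta> f * E g) \<and> (\<forall>c. E (const c) = 0) \<and> \<theta> F = 0 \<and> E F = 1)"

text \<open>If \<open>f\<close> generates the ideal of the curve, then \<open>p \<mapsto> (p - \<phi> p) / f\<close> is a derivation along the
  curve that takes the value 1 at \<open>f\<close>.\<close>

lemma smooth_curve_of_retraction:
  assumes \<theta>: "curve_hom \<theta>" and deg: "degree (\<theta> var_x) > 0"
    and \<phi>: "alg_endo \<phi>" and \<theta>\<phi>: "\<And>p. \<theta> (\<phi> p) = \<theta> p" and ker: "\<And>p. \<theta> p = 0 \<Longrightarrow> \<phi> p = 0"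
  shows "smooth_curve \<theta>"
proof -
  let ?B = "curve_eval (\<theta> var_x) (\<theta> var_y)"
  obtain f where f: "lead_coeff f = 1" "?B f = 0" "\<And>P. ?B P = 0 \<Longrightarrow> f dvd P"
    using minimal_relation_exists[OF deg] by blast
  have f0: "f \<noteq> 0" using f(1) by auto
  \<comment> \<open>The map \<theta> does not distinguish \<open>p\<close> from
    \<open>\<phi> p\<close>, so their difference is a relation on the curve.\<close>
  have "f dvd abel (p - \<phi> p)" for p
    using curve_hom_abel[OF \<theta>, of "p - \<phi> p"] \<theta>\<phi> by (intro f(3)) (simp add: curve_hom_diff[OF \<theta>])
  then obtain q where q: "\<And>p. abel (p - \<phi> p) = f * q p" unfolding dvd_def by metis
  have qI: "q p = Q" if "abel (p - \<phi> p) = f * Q" for p Q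
    using that q[of p] f0 by simp
  define E where "E = (\<lambda>p. ?B (q p))"
  have "E (p + r) = E p + E r" for p r
  proof -
    have "abel (p + r - \<phi> (p + r)) = f * (q p + q r)"
      using q[of p] q[of r] by (simp add: abel_diff abel_add alg_endo_add[OF \<phi>] algebra_simps)
    from qI[OF this] show ?thesis by (simp add: E_def curve_eval.hom_add)
  qed
  moreover have "E (p * r) = E p * \<theta> r + \<theta> p * E r" for p r
  proof -
    have eq: "p * r - \<phi> (p * r) = (p - \<phi> p) * r + \<phi> p * (r - \<phi> r)"
      by (simp add: alg_endo_mult[OF \<phi>] algebra_simps)
    have "abel (p * r - \<phi> (p * r)) = f * (q p * abel r + abel (\<phi> p) * q r)"
      unfolding eq abel_add abel_mult q by (simp add: algebra_simps)
    from qI[OF this] show ?thesis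
      using curve_hom_abel[OF \<theta>, of r] curve_hom_abel[OF \<theta>, of "\<phi> p"] \<theta>\<phi>
      by (simp add: E_def curve_eval.hom_add curve_eval.hom_mult)
  qed
  moreover have "E (const c) = 0" for c
  proof -
    have "q (const c) = 0" by (rule qI) (simp add: alg_endo_const[OF \<phi>] abel_0)
    then show ?thesis by (simp add: E_def)
  qed
  moreover obtain F where F: "abel F = f" using abel_surj by blast
  moreover have "\<theta> F = 0" using curve_hom_abel[OF \<theta>, of F] F f(2) by simp
  moreover have "E F = 1" using qI[of F 1] ker[OF \<open>\<theta> F = 0\<close>] F by (simp add: E_def)
  ultimately show ?thesis unfolding smooth_curve_def by blast
qed

lemma smooth_curve_comp:
  assumes "smooth_curve \<theta>" "alg_auto \<psi>"
  shows "smooth_curve (\<theta> \<circ> \<psi>)"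
proof -
  have \<psi>: "alg_endo \<psi>" using assms(2) by (simp add: alg_auto_def)
  obtain \<psi>' where "\<And>f. \<psi> (\<psi>' f) = f" using alg_auto_inverse[OF assms(2)] by blast
  moreover obtain E F where "\<And>f g. E (f + g) = E f + E g" "\<And>f g. E (f * g) = E f * \<theta> g + \<theta> f * E g"
    "\<And>c. E (const c) = 0" "\<theta> F = 0" "E F = 1" using assms(1) unfolding smooth_curve_def by blast
  ultimately show ?thesis
    unfolding smooth_curve_def
    by (intro exI[of _ "E \<circ> \<psi>"] exI[of _ "\<psi>' F"])
      (simp add: alg_endo_add[OF \<psi>] alg_endo_mult[OF \<psi>] alg_endo_const[OF \<psi>])
qed

lemma smooth_curve_degree_dvd:
  fixes \<theta> :: "'k::field_char_0 free_alg \<Rightarrow> 'k poly"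
  assumes "smooth_curve \<theta>" and \<theta>: "curve_hom \<theta>" and deg: "degree (\<theta> var_x) > 0" "degree (\<theta> var_y) > 0"
  shows "degree (\<theta> var_x) dvd degree (\<theta> var_y) \<or> degree (\<theta> var_y) dvd degree (\<theta> var_x)"
proof -
  let ?u = "\<theta> var_x" and ?v = "\<theta> var_y"
  let ?B = "curve_eval ?u ?v"
  obtain E F where E: "\<And>f g. E (f + g) = E f + E g" "\<And>f g. E (f * g) = E f * \<theta> g + \<theta> f * E g"
    "\<And>c. E (const c) = 0" "\<theta> F = 0" "E F = 1" using assms(1) unfolding smooth_curve_def by blast
  obtain f where f: "lead_coeff f = 1" "?B f = 0" "\<And>P. ?B P = 0 \<Longrightarrow> f dvd P"
    using minimal_relation_exists[OF deg(1)] by blast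
  \<comment> \<open>This combines two derivations along \<theta>, namely \<open>E\<close> and the
    derivative of \<open>\<theta> p\<close>, so as to kill \<open>var_x\<close>; its value at
    \<open>var_y\<close> then determines it by the chain rule. At \<open>F\<close> the second one
    vanishes, and \<open>pderiv ?u\<close> remains.\<close>
  define D where "D = (\<lambda>p. pderiv ?u * E p - E var_x * pderiv (\<theta> p))"
  have D: "D p = ?B (pderiv (abel p)) * D var_y" for p
  proof (induction p rule: free_alg_induct)
    case (const c)
    then show ?case by (simp add: D_def E curve_hom_const[OF \<theta>] pderiv_pCons)
  next
    case var_x
    then show ?case by (simp add: D_def pderiv_pCons)
  next
    case var_y
    then show ?case by (simp add: pderiv_pCons)
  next
    case (add f g)
    have "D (f + g) = D f + D g"
      by (simp add: D_def E curve_hom_add[OF \<theta>] pderiv_add algebra_simps)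
    then show ?case using add by (simp add: abel_add pderiv_add curve_eval.hom_add algebra_simps)
  next
    case (mult f g)
    have "D (f * g) = D f * \<theta> g + \<theta> f * D g"
      by (simp add: D_def E curve_hom_mult[OF \<theta>] pderiv_mult algebra_simps)
    then show ?case using mult curve_hom_abel[OF \<theta>, of f] curve_hom_abel[OF \<theta>, of g]
      by (simp add: abel_mult pderiv_mult curve_eval.hom_add curve_eval.hom_mult algebra_simps)
  qed
  have "f dvd abel F" using curve_hom_abel[OF \<theta>, of F] E(4) by (intro f(3)) simp
  then obtain Q where "abel F = f * Q" ..
  then have "?B (pderiv (abel F)) = ?B (pderiv f) * ?B Q"
    using f(2) by (simp add: pderiv_mult curve_eval.hom_add curve_eval.hom_mult mult.commute)
  moreover have "D F = pderiv ?u" by (simp add: D_def E)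
  ultimately have "pderiv ?u = ?B (pderiv f) * (?B Q * D var_y)" using D[of F] by (simp add: mult.assoc)
  then have "?B (pderiv f) dvd pderiv ?u" by (rule dvdI)
  from degree_dvd_of_smooth[OF deg f this] show ?thesis .
qed

section \<open>Reduction of degrees by elementary automorphisms\<close>

lemma straighten_constant:
  fixes \<theta> :: "'k::field free_alg \<Rightarrow> 'k poly"
  assumes \<theta>: "curve_hom \<theta>" and nc: "degree (\<theta> var_x) > 0 \<or> degree (\<theta> var_y) > 0"
    and c: "degree (\<theta> var_x) = 0 \<or> degree (\<theta> var_y) = 0"
  shows "\<exists>\<psi>. alg_auto \<psi> \<and> \<theta> (\<psi> var_y) = 0 \<and> degree (\<theta> (\<psi> var_x)) > 0"
proof (cases "degree (\<theta> var_y) = 0")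
  case True
  obtain d where d: "\<theta> var_y = [:d:]" using True by (rule degree_eq_zeroE)
  let ?\<psi> = "subst (var_x + const 0) (var_y + const (- d))"
  have "\<theta> (?\<psi> var_y) = 0" using d by (simp add: curve_hom_add[OF \<theta>] curve_hom_const[OF \<theta>])
  moreover have "degree (\<theta> (?\<psi> var_x)) > 0" using True nc by simp
  ultimately show ?thesis using alg_auto_translation by blast
next
  case False
  then obtain d where d: "\<theta> var_x = [:d:]" using c by (metis degree_eq_zeroE)
  let ?\<psi> = "subst var_y var_x \<circ> subst (var_x + const 0) (var_y + const (- d))"
  have "\<theta> (?\<psi> var_y) = 0" using d by (simp add: subst_add curve_hom_add[OF \<theta>] curve_hom_const[OF \<theta>])
  moreover have "degree (\<theta> (?\<psi> var_x)) > 0" using False by simp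
  ultimately show ?thesis using alg_auto_comp[OF alg_auto_swap alg_auto_translation] by blast
qed

lemma degree_reduce:
  fixes u v :: "'k::field poly"
  assumes "degree u > 0" "degree v > 0" "degree u dvd degree v"
  shows "\<exists>c k. degree (v + [:c:] * u ^ k) < degree v"
proof -
  obtain k where k: "degree v = degree u * k" using assms(3) ..
  define c where "c = lead_coeff v / lead_coeff u ^ k"
  have u: "u \<noteq> 0" using assms(1) by auto
  have "degree (v - smult c (u ^ k)) < degree v"
  proof (rule degree_diff_lead_less)
    show "degree (smult c (u ^ k)) \<le> degree v"
      using degree_smult_le[of c "u ^ k"] degree_power_le[of u k] k by linarith
    have "coeff (u ^ k) (degree v) = lead_coeff u ^ k"
      using u k by (simp add: degree_power_eq mult.commute flip: lead_coeff_power)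
    then show "coeff v (degree v) = coeff (smult c (u ^ k)) (degree v)" using u by (simp add: c_def)
  qed (use assms in auto)
  then show ?thesis by (intro exI[of _ "- c"] exI[of _ k]) simp
qed

lemma straighten:
  fixes \<theta> :: "'k::field_char_0 free_alg \<Rightarrow> 'k poly"
  assumes "curve_hom \<theta>" "smooth_curve \<theta>" "degree (\<theta> var_x) > 0 \<or> degree (\<theta> var_y) > 0"
  shows "\<exists>\<psi>. alg_auto \<psi> \<and> \<theta> (\<psi> var_y) = 0 \<and> degree (\<theta> (\<psi> var_x)) > 0"
  using assms
proof (induction "degree (\<theta> var_x) + degree (\<theta> var_y)" arbitrary: \<theta> rule: less_induct)
  case less
  \<comment> \<open>Composition with an automorphism preserves smoothness, so it suffices that the
    sum of the degrees drops while the first coordinate stays nonconstant.\<close>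
  have step: ?case if \<psi>: "alg_auto \<psi>" and
    lt: "degree (\<theta> (\<psi> var_x)) + degree (\<theta> (\<psi> var_y)) < degree (\<theta> var_x) + degree (\<theta> var_y)"
    and nc: "degree (\<theta> (\<psi> var_x)) > 0" for \<psi>
  proof -
    have "\<exists>\<psi>'. alg_auto \<psi>' \<and> (\<theta> \<circ> \<psi>) (\<psi>' var_y) = 0 \<and> degree ((\<theta> \<circ> \<psi>) (\<psi>' var_x)) > 0"
      using lt nc \<psi> less.prems(1,2)
      by (intro less.hyps curve_hom_comp smooth_curve_comp) (auto simp: alg_auto_def)
    then obtain \<psi>' where "alg_auto \<psi>'" "\<theta> ((\<psi> \<circ> \<psi>') var_y) = 0" "degree (\<theta> ((\<psi> \<circ> \<psi>') var_x)) > 0"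
      by auto
    then show ?thesis using alg_auto_comp[OF \<psi>] by blast
  qed
  note \<theta> = less.prems(1)
  show ?case
  proof (cases "degree (\<theta> var_x) = 0 \<or> degree (\<theta> var_y) = 0")
    case True
    then show ?thesis using straighten_constant[OF \<theta> less.prems(3)] by blast
  next
    case False
    then have pos: "degree (\<theta> var_x) > 0" "degree (\<theta> var_y) > 0" by auto
    from smooth_curve_degree_dvd[OF less.prems(2) \<theta> pos] show ?thesis
    proof
      assume "degree (\<theta> var_x) dvd degree (\<theta> var_y)"
      from degree_reduce[OF pos this] obtain c k
        where ck: "degree (\<theta> var_y + [:c:] * \<theta> var_x ^ k) < degree (\<theta> var_y)" by blast
      show ?thesis
        by (rule step[OF alg_auto_elementary[of c k]])
          (use ck pos in \<open>simp_all add: curve_hom_add[OF \<theta>] curve_hom_mult[OF \<theta>] curve_hom_const[OF \<theta>] curve_hom_power[OF \<theta>]\<close>)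
    next
      assume "degree (\<theta> var_y) dvd degree (\<theta> var_x)"
      from degree_reduce[OF pos(2,1) this] obtain c k
        where ck: "degree (\<theta> var_x + [:c:] * \<theta> var_y ^ k) < degree (\<theta> var_x)" by blast
      \<comment> \<open>This composite sends \<open>var_x\<close> to \<open>var_y\<close> and
        \<open>var_y\<close> to \<open>var_x + const c * var_y ^ k\<close>: the previous case with
        the coordinates exchanged.\<close>
      show ?thesis
        by (rule step[OF alg_auto_comp[OF alg_auto_swap alg_auto_elementary[of c k]]])
          (use ck pos in \<open>simp_all add: subst_add subst_mult alg_endo_power[OF alg_endo_subst]
            curve_hom_add[OF \<theta>] curve_hom_mult[OF \<theta>] curve_hom_const[OF \<theta>] curve_hom_power[OF \<theta>]\<close>)
    qed
  qed
qed

section \<open>Idempotent endomorphisms\<close>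

lemma lookup_const_mult: "Poly_Mapping.lookup (const c * f) w = c * Poly_Mapping.lookup f (w :: word)"
  for f :: "'k::field free_alg"
proof (induction f rule: additive_induct)
  case (1 w' d)
  show ?case by (simp add: const_def mult_single lookup_single when_def)
qed (simp add: distrib_left lookup_add)

lemma lookup_const: "Poly_Mapping.lookup (const c) 0 = (c :: 'k::field)"
  by (simp add: const_def lookup_single)

lemma lookup_0_mult:
  "Poly_Mapping.lookup (f * g) 0 = Poly_Mapping.lookup f 0 * Poly_Mapping.lookup (g :: 'k::field free_alg) 0"
  using lookup_mult_split[of f g "[]"] by (simp add: zero_word_def)

lemma alg_endo_eq_eval:
  assumes "alg_endo \<phi>"
  shows "\<phi> f = (\<Sum>w\<in>Poly_Mapping.keys f. const (Poly_Mapping.lookup f w) * word_val (case_letter (\<phi> var_x) (\<phi> var_y)) w)"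
proof -
  have "\<phi> = subst (\<phi> var_x) (\<phi> var_y)"
    using assms by (intro alg_endo_eqI alg_endo_subst) simp_all
  then have "\<phi> f = subst (\<phi> var_x) (\<phi> var_y) f" by simp
  then show ?thesis by (simp add: subst_def fa_eval_def)
qed

text \<open>A factor without constant term uses up at least one letter. A word with as many letters
  as there are factors takes exactly one from each, hence a linear coefficient.\<close>

lemma lookup_word_val_low:
  fixes val :: "letter \<Rightarrow> 'k::field free_alg"
  assumes "\<And>l. Poly_Mapping.lookup (val l) 0 = 0" "length ls \<le> length us"
  shows "Poly_Mapping.lookup (word_val val (Word us)) (Word ls) =
    (if length ls = length us then prod_list (map2 (\<lambda>a b. Poly_Mapping.lookup (val a) (Word [b])) us ls) else 0)"
  using assms(2)
proof (induction us arbitrary: ls)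
  case Nil
  then show ?case by (simp add: word_val_def zero_word_def lookup_one)
next
  case (Cons u us)
  have split: "Poly_Mapping.lookup (word_val val (Word (u # us))) (Word ls) =
    (\<Sum>i\<le>length ls. Poly_Mapping.lookup (val u) (Word (take i ls)) * Poly_Mapping.lookup (word_val val (Word us)) (Word (drop i ls)))"
    (is "_ = sum ?t _") using lookup_mult_split[of "val u" "word_val val (Word us)" ls] by (simp add: word_val_def)
  have t: "?t i = 0" if "i \<noteq> 1" "i \<le> length ls" for i
  proof (cases "i = 0")
    case True
    then show ?thesis using assms(1)[of u] by (simp add: zero_word_def)
  next
    case False
    then have "length (drop i ls) < length us" using that Cons.prems by simp
    then show ?thesis using Cons.IH[of "drop i ls"] by simp
  qed
  show ?case
  proof (cases ls)
    case Nil
    then show ?thesis unfolding split using t by simp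
  next
    case (Cons l ls')
    have "sum ?t {..length ls} = sum ?t {1}"
      using t Cons by (intro sum.mono_neutral_right) auto
    then show ?thesis unfolding split using Cons Cons.IH[of ls'] Cons.prems by simp
  qed
qed

text \<open>Longer words of \<open>r\<close> contribute only in higher degrees, so in its lowest
  degree \<open>r\<close> is transformed by the linear part of \<phi> alone.\<close>

lemma lookup_endo_lowest:
  fixes \<phi> :: "'k::field free_alg \<Rightarrow> 'k free_alg"
  assumes \<phi>: "alg_endo \<phi>"
    and "Poly_Mapping.lookup (\<phi> var_x) 0 = 0" "Poly_Mapping.lookup (\<phi> var_y) 0 = 0"
    and low: "\<And>us. length us < length ls \<Longrightarrow> Poly_Mapping.lookup r (Word us) = 0"
  shows "Poly_Mapping.lookup (\<phi> r) (Word ls) =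
    (\<Sum>w\<in>Poly_Mapping.keys r. if length (letters w) = length ls then Poly_Mapping.lookup r w *
       prod_list (map2 (\<lambda>a b. Poly_Mapping.lookup (case_letter (\<phi> var_x) (\<phi> var_y) a) (Word [b])) (letters w) ls) else 0)"
proof -
  let ?val = "case_letter (\<phi> var_x) (\<phi> var_y)"
  have v0: "Poly_Mapping.lookup (?val l) 0 = 0" for l using assms(2,3) by (cases l) simp_all
  show ?thesis
    unfolding alg_endo_eq_eval[OF \<phi>, of r] lookup_sum lookup_const_mult
  proof (intro sum.cong refl)
    fix w assume w: "w \<in> Poly_Mapping.keys r"
    obtain us where us: "w = Word us" by (cases w)
    have "\<not> length us < length ls" using low[of us] w us by (auto simp: in_keys_iff)
    then show "Poly_Mapping.lookup r w * Poly_Mapping.lookup (word_val ?val w) (Word ls) =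
      (if length (letters w) = length ls then Poly_Mapping.lookup r w *
       prod_list (map2 (\<lambda>a b. Poly_Mapping.lookup (?val a) (Word [b])) (letters w) ls) else 0)"
      using lookup_word_val_low[of ?val ls us, OF v0] us by simp
  qed
qed

lemma exists_lowest:
  assumes "r \<noteq> (0 :: 'k::field free_alg)"
  shows "\<exists>ls. Poly_Mapping.lookup r (Word ls) \<noteq> 0 \<and> (\<forall>us. length us < length ls \<longrightarrow> Poly_Mapping.lookup r (Word us) = 0)"
proof -
  obtain w where "Poly_Mapping.lookup r w \<noteq> 0" using assms poly_mapping_eqI[of r 0] by auto
  then have "\<exists>us. Poly_Mapping.lookup r (Word us) \<noteq> 0" by (metis word.exhaust)
  then obtain ls where "Poly_Mapping.lookup r (Word ls) \<noteq> 0"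
    "\<forall>us. Poly_Mapping.lookup r (Word us) \<noteq> 0 \<longrightarrow> length ls \<le> length us"
    using ex_has_least_nat[of "\<lambda>us. Poly_Mapping.lookup r (Word us) \<noteq> 0" _ length] by blast
  then show ?thesis by (intro exI[of _ ls]) force
qed

text \<open>If the determinant is nonzero, multiplying \<open>J^2 = J\<close> by the adjugate gives
  the identity. Otherwise the rank is at most 1 and the matrix is a column times a row.\<close>

lemma idempotent_2x2_cases:
  fixes J :: "letter \<Rightarrow> letter \<Rightarrow> 'k::field"
  assumes "\<And>a b. J a X * J X b + J a Y * J Y b = J a b"
  shows "(\<forall>a b. J a b = (if a = b then 1 else 0)) \<or> (\<exists>\<mu> \<nu>. \<forall>a b. J a b = \<mu> a * \<nu> b)"
proof (cases "J X X * J Y Y = J X Y * J Y X")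
  case False
  define D where "D = J X X * J Y Y - J X Y * J Y X"
  have D: "D \<noteq> 0" using False by (simp add: D_def)
  have e: "J X X * J X X + J X Y * J Y X = J X X" "J X X * J X Y + J X Y * J Y Y = J X Y"
    "J Y X * J X X + J Y Y * J Y X = J Y X" "J Y X * J X Y + J Y Y * J Y Y = J Y Y"
    using assms by blast+
  have "D * J X X = J Y Y * (J X X * J X X + J X Y * J Y X) - J X Y * (J Y X * J X X + J Y Y * J Y X)"
    "D * J X Y = J Y Y * (J X X * J X Y + J X Y * J Y Y) - J X Y * (J Y X * J X Y + J Y Y * J Y Y)"
    "D * J Y X = J X X * (J Y X * J X X + J Y Y * J Y X) - J Y X * (J X X * J X X + J X Y * J Y X)"
    "D * J Y Y = J X X * (J Y X * J X Y + J Y Y * J Y Y) - J Y X * (J X X * J X Y + J X Y * J Y Y)"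
    by (simp_all add: D_def algebra_simps)
  then have "D * J X X = D" "D * J X Y = 0" "D * J Y X = 0" "D * J Y Y = D"
    unfolding e by (simp_all add: D_def mult.commute)
  then have "J X X = 1" "J X Y = 0" "J Y X = 0" "J Y Y = 1" using D by auto
  then have "J a b = (if a = b then 1 else 0)" for a b by (cases a; cases b) auto
  then show ?thesis by blast
next
  case True
  have "\<exists>\<mu> \<nu>. \<forall>a b. J a b = \<mu> a * \<nu> b"
  proof (cases "\<forall>b. J X b = 0")
    case True
    then have "J a b = case_letter 0 1 a * J Y b" for a b by (cases a) auto
    then show ?thesis by blast
  next
    case False
    then obtain c where c: "J X c \<noteq> 0" by blast
    have "J Y b * J X c = J Y c * J X b" for b
      using True by (cases b; cases c) (auto simp: mult.commute)
    then have JY: "J Y b = (J Y c / J X c) * J X b" for b using c by (simp add: eq_divide_eq)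
    have "J a b = case_letter 1 (J Y c / J X c) a * J X b" for a b
    proof (cases a)
      case Y
      show ?thesis unfolding Y letter.case by (rule JY)
    qed simp
    then show ?thesis by blast
  qed
  then show ?thesis ..
qed

lemma centered_idempotent_cases:
  fixes \<phi> :: "'k::field free_alg \<Rightarrow> 'k free_alg"
  assumes \<phi>: "alg_endo \<phi>" and idem: "\<And>p. \<phi> (\<phi> p) = \<phi> p"
    and centered: "Poly_Mapping.lookup (\<phi> var_x) 0 = 0" "Poly_Mapping.lookup (\<phi> var_y) 0 = 0"
  shows "\<phi> = id \<or> (\<exists>\<theta>. curve_hom \<theta> \<and> (\<forall>p. \<theta> (\<phi> p) = \<theta> p) \<and> (\<forall>p. \<theta> p = 0 \<longrightarrow> \<phi> p = 0))"
proof -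
  let ?val = "case_letter (\<phi> var_x) (\<phi> var_y)"
  define J where "J = (\<lambda>a b. Poly_Mapping.lookup (?val a) (Word [b]))"
  note lowest = lookup_endo_lowest[OF \<phi> centered, folded J_def]
  have "J a X * J X b + J a Y * J Y b = J a b" for a b
  proof -
    have "\<phi> (?val a) = ?val a" using idem by (cases a) simp_all
    then have "J a b = Poly_Mapping.lookup (\<phi> (?val a)) (Word [b])" by (simp add: J_def)
    also have "\<dots> = (\<Sum>w\<in>Poly_Mapping.keys (?val a). if length (letters w) = 1 then
        Poly_Mapping.lookup (?val a) w * prod_list (map2 J (letters w) [b]) else 0)"
      using lowest[of "[b]" "?val a"] centered by (cases a) (auto simp: zero_word_def)
    also have "\<dots> = (\<Sum>w\<in>{Word [X], Word [Y]}. Poly_Mapping.lookup (?val a) w * J (hd (letters w)) b)"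
    proof (rule sum.mono_neutral_cong)
      show "(if length (letters w) = 1 then Poly_Mapping.lookup (?val a) w * prod_list (map2 J (letters w) [b]) else 0) = 0"
        if w: "w \<in> Poly_Mapping.keys (?val a) - {Word [X], Word [Y]}" for w
      proof -
        have "length (letters w) \<noteq> 1"
        proof
          assume "length (letters w) = 1"
          then obtain l where "w = Word [l]" by (cases w) (auto simp: length_Suc_conv)
          then show False using w by (cases l) auto
        qed
        then show ?thesis by simp
      qed
    qed (auto simp: in_keys_iff)
    finally show ?thesis by (simp add: J_def)
  qed
  from idempotent_2x2_cases[of J, OF this] show ?thesis
  proof (elim disjE exE)
    assume J1: "\<forall>a b. J a b = (if a = b then 1 else 0)"
    have prod: "prod_list (map2 J us ls) = (if us = ls then 1 else 0)" if "length us = length ls" for us ls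
      using that by (induction us ls rule: list_induct2) (auto simp: J1)
    \<comment> \<open>When the linear part is the identity, the lowest form of \<open>r\<close>
      survives in \<open>\<phi> r\<close>; the differences \<open>\<phi> p - p\<close> lie in the
      kernel and hence vanish.\<close>
    have inj: "r = 0" if r: "\<phi> r = 0" for r
    proof (rule ccontr)
      assume "r \<noteq> 0"
      then obtain ls where ls: "Poly_Mapping.lookup r (Word ls) \<noteq> 0"
        "\<And>us. length us < length ls \<Longrightarrow> Poly_Mapping.lookup r (Word us) = 0" using exists_lowest by blast
      have "Poly_Mapping.lookup (\<phi> r) (Word ls) =
        (\<Sum>w\<in>Poly_Mapping.keys r. if w = Word ls then Poly_Mapping.lookup r w else 0)"
      proof (rule trans[OF lowest], goal_cases)
        case (1 us)
        then show ?case by (rule ls(2))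
      next
        case 2
        show ?case
        proof (intro sum.cong refl)
          fix w
          show "(if length (letters w) = length ls then Poly_Mapping.lookup r w * prod_list (map2 J (letters w) ls) else 0)
            = (if w = Word ls then Poly_Mapping.lookup r w else 0)"
            by (cases w) (auto simp: prod)
        qed
      qed
      also have "\<dots> = Poly_Mapping.lookup r (Word ls)" using ls(1) by (simp add: in_keys_iff)
      finally show False using ls(1) r by simp
    qed
    have "\<phi> p = p" for p
      using inj[of "\<phi> p - p"] by (simp add: alg_endo_diff[OF \<phi>] idem)
    then show ?thesis by auto
  next
    fix \<mu> \<nu> assume J2: "\<forall>a b. J a b = \<mu> a * \<nu> b"
    have prod: "prod_list (map2 J us ls) = prod_list (map \<mu> us) * prod_list (map \<nu> ls)"
      if "length us = length ls" for us ls
      using that by (induction us ls rule: list_induct2) (auto simp: J2)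
    \<comment> \<open>Restriction to the line through the origin in the direction of \<mu>, the
      column factor of the linear part.\<close>
    define \<epsilon> where "\<epsilon> = fa_eval (\<lambda>c. [:c:]) (\<lambda>l. [:0, \<mu> l:])"
    have \<epsilon>: "curve_hom \<epsilon>"
      by (simp add: curve_hom_def \<epsilon>_def line_eval.fa_eval_add line_eval.fa_eval_mult line_eval.fa_eval_const)
    have word_val: "word_val (\<lambda>l. [:0, \<mu> l:]) (Word us) = monom (prod_list (map \<mu> us)) (length us)" for us
      by (induction us) (simp_all add: word_val_def monom_Suc mult.commute smult_monom flip: one_pCons)
    have coeff_\<epsilon>: "coeff (\<epsilon> r) k = (\<Sum>w\<in>Poly_Mapping.keys r. if length (letters w) = k
        then Poly_Mapping.lookup r w * prod_list (map \<mu> (letters w)) else 0)" for r k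
      unfolding \<epsilon>_def fa_eval_def coeff_sum
    proof (intro sum.cong refl)
      fix w
      show "coeff ([:Poly_Mapping.lookup r w:] * word_val (\<lambda>l. [:0, \<mu> l:]) w) k =
        (if length (letters w) = k then Poly_Mapping.lookup r w * prod_list (map \<mu> (letters w)) else 0)"
        by (cases w) (simp add: word_val)
    qed
    \<comment> \<open>In rank one each lowest coefficient of \<open>\<phi> r\<close> is a
      coefficient of \<open>\<epsilon> r\<close> times a product of values of \<nu>. So \<epsilon>
      detects the elements fixed by \<phi>, which form the retract.\<close>
    have inj: "r = 0" if r: "\<phi> r = r" "\<epsilon> r = 0" for r
    proof (rule ccontr)
      assume "r \<noteq> 0"
      then obtain ls where ls: "Poly_Mapping.lookup r (Word ls) \<noteq> 0"
        "\<And>us. length us < length ls \<Longrightarrow> Poly_Mapping.lookup r (Word us) = 0" using exists_lowest by blast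
      have "Poly_Mapping.lookup (\<phi> r) (Word ls) = coeff (\<epsilon> r) (length ls) * prod_list (map \<nu> ls)"
      proof (rule trans[OF lowest], goal_cases)
        case (1 us)
        then show ?case by (rule ls(2))
      next
        case 2
        show ?case unfolding coeff_\<epsilon> sum_distrib_right by (intro sum.cong refl) (auto simp: prod)
      qed
      then show False using ls(1) r by simp
    qed
    have "curve_hom (\<epsilon> \<circ> \<phi>)" using \<epsilon> \<phi> by (rule curve_hom_comp)
    moreover have "\<forall>p. (\<epsilon> \<circ> \<phi>) (\<phi> p) = (\<epsilon> \<circ> \<phi>) p" by (simp add: idem)
    moreover have "\<forall>p. (\<epsilon> \<circ> \<phi>) p = 0 \<longrightarrow> \<phi> p = 0" using inj idem by simp
    ultimately show ?thesis by blast
  qed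
qed

section \<open>Computing modulo y and commutators\<close>

lemma commutator_ideal_closed:
  shows "0 \<in> commutator_ideal" "f \<in> commutator_ideal \<Longrightarrow> g \<in> commutator_ideal \<Longrightarrow> f + g \<in> commutator_ideal"
    and "f \<in> commutator_ideal \<Longrightarrow> h * f \<in> commutator_ideal" "f \<in> commutator_ideal \<Longrightarrow> f * h \<in> commutator_ideal"
  unfolding commutator_ideal_def hull_def two_sided_ideal_def by auto

lemma commutator_in_ideal: "a * b - b * a \<in> commutator_ideal"
  unfolding commutator_ideal_def by (rule hull_inc) blast

text \<open>Since \<open>h * var_y\<close> is \<open>var_y * h\<close> up to a commutator, the right
  multiples of \<open>var_y\<close> together with the commutator ideal form a two-sided ideal;
  modulo it, setting \<open>y = 0\<close> changes nothing.\<close>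

lemma eq_modulo_y_and_commutators:
  fixes f :: "'k::field free_alg"
  shows "\<exists>q w. f = subst var_x 0 f + var_y * q + w \<and> w \<in> commutator_ideal"
proof -
  define N :: "'k free_alg set" where "N = {var_y * q + w |q w. w \<in> commutator_ideal}"
  have N_I: "w \<in> commutator_ideal \<Longrightarrow> var_y * q + w \<in> N" for q w by (auto simp: N_def)
  have N_0: "0 \<in> N" using N_I[OF commutator_ideal_closed(1), of 0] by simp
  have N_add: "f + g \<in> N" if "f \<in> N" "g \<in> N" for f g
  proof -
    obtain q w q' w' where *: "f = var_y * q + w" "w \<in> commutator_ideal" "g = var_y * q' + w'" "w' \<in> commutator_ideal"
      using \<open>f \<in> N\<close> \<open>g \<in> N\<close> by (auto simp: N_def)
    have "f + g = var_y * (q + q') + (w + w')" using * by (simp add: algebra_simps)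
    then show ?thesis using N_I[OF commutator_ideal_closed(2)[OF *(2,4)]] by simp
  qed
  have N_mult: "h * f \<in> N" "f * h \<in> N" if "f \<in> N" for f h
  proof -
    obtain q w where *: "f = var_y * q + w" "w \<in> commutator_ideal" using \<open>f \<in> N\<close> by (auto simp: N_def)
    have "h * f = var_y * (h * q) + ((h * var_y - var_y * h) * q + h * w)"
      using * by (simp add: algebra_simps)
    moreover have "(h * var_y - var_y * h) * q + h * w \<in> commutator_ideal"
      using *(2) by (intro commutator_ideal_closed commutator_in_ideal)
    ultimately show "h * f \<in> N" using N_I by metis
    have "f * h = var_y * (q * h) + w * h" using * by (simp add: algebra_simps)
    then show "f * h \<in> N" using N_I[OF commutator_ideal_closed(4)[OF *(2)]] by simp
  qed
  have "f - subst var_x 0 f \<in> N"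
  proof (induction f rule: free_alg_induct)
    case var_y
    then show ?case using N_I[OF commutator_ideal_closed(1), of 1] by simp
  next
    case (add f g)
    have "f + g - subst var_x 0 (f + g) = (f - subst var_x 0 f) + (g - subst var_x 0 g)"
      by (simp add: subst_add)
    then show ?case by (simp only: N_add[OF add])
  next
    case (mult f g)
    have "f * g - subst var_x 0 (f * g) = (f - subst var_x 0 f) * g + subst var_x 0 f * (g - subst var_x 0 g)"
      by (simp add: subst_mult algebra_simps)
    then show ?case by (simp only: N_add[OF N_mult(2)[OF mult(1)] N_mult(1)[OF mult(2)]])
  qed (use N_0 in simp_all)
  then obtain q w where "f - subst var_x 0 f = var_y * q + w" "w \<in> commutator_ideal" by (auto simp: N_def)
  then show ?thesis by (intro exI[of _ q] exI[of _ w]) (simp add: algebra_simps)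
qed

definition on_x_axis :: "'k::field free_alg \<Rightarrow> 'k poly" where
  "on_x_axis = fa_eval (\<lambda>c. [:c:]) (case_letter [:0, 1:] 0)"

lemma on_x_axis_simps:
  "on_x_axis (f + g) = on_x_axis f + on_x_axis g" "on_x_axis (f * g) = on_x_axis f * on_x_axis g"
  "on_x_axis (const c) = [:c:]" "on_x_axis var_x = [:0, 1:]" "on_x_axis var_y = 0"
  by (simp_all add: on_x_axis_def line_eval.fa_eval_add line_eval.fa_eval_mult line_eval.fa_eval_const line_eval.fa_eval_x line_eval.fa_eval_y)

text \<open>Words without the letter \<open>Y\<close> are determined by their length, so what is
  left after setting \<open>y = 0\<close> can be read off from a polynomial in one variable.\<close>

lemma lookup_subst_x_0:
  "Poly_Mapping.lookup (subst var_x 0 f) (Word ls) = (if Y \<in> set ls then 0 else coeff (on_x_axis f) (length ls))"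
proof (induction f rule: additive_induct)
  case (1 w c)
  obtain us where w: "w = Word us" by (cases w)
  have 1: "word_val (case_letter var_x 0) (Word us) = (if Y \<in> set us then 0 else Poly_Mapping.single (Word us) (1 :: 'a))"
  proof (induction us)
    case Nil
    show ?case by (simp add: word_val_def) (simp flip: zero_word_def)
  next
    case (Cons l us)
    then show ?case by (cases l) (auto simp: word_val_def var_x_def mult_single plus_word_def)
  qed
  have 2: "word_val (case_letter [:0, 1:] 0) (Word us) = (if Y \<in> set us then 0 else monom (1 :: 'a) (length us))"
  proof (induction us)
    case (Cons l us)
    then show ?case by (cases l) (auto simp: word_val_def monom_Suc)
  qed (simp add: word_val_def)
  have rep: "us = ls" if "Y \<notin> set us" "Y \<notin> set ls" "length us = length ls"
  proof -
    have "l = X" if "l \<noteq> Y" for l using that by (cases l) auto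
    then have "us = replicate (length us) X" "ls = replicate (length ls) X"
      using that by (metis replicate_length_same)+
    then show ?thesis using that(3) by metis
  qed
  show ?case
    using rep by (auto simp: w subst_def on_x_axis_def endo_eval.fa_eval_single line_eval.fa_eval_single 1 2 lookup_const_mult
        lookup_single when_def)
next
  case (2 f g)
  then show ?case by (simp add: subst_add lookup_add on_x_axis_simps)
qed

lemma subst_x_0_eqI:
  assumes "on_x_axis f = on_x_axis g"
  shows "subst var_x 0 f = subst var_x 0 g"
proof (rule poly_mapping_eqI)
  fix w show "Poly_Mapping.lookup (subst var_x 0 f) w = Poly_Mapping.lookup (subst var_x 0 g) w"
    by (cases w) (simp add: lookup_subst_x_0 assms)
qed

lemma range_eq_gen_subalgebra:
  fixes \<phi> :: "'k::field free_alg \<Rightarrow> 'k free_alg"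
  assumes "alg_endo \<phi>" "\<phi> var_y = 0"
  shows "range \<phi> = gen_subalgebra (\<phi> var_x)"
proof
  show "range \<phi> \<subseteq> gen_subalgebra (\<phi> var_x)"
    unfolding gen_subalgebra_def hull_def
  proof safe
    fix f T assume T: "subalgebra T" "{\<phi> var_x} \<subseteq> T"
    have c: "const c \<in> T" for c using T(1) unfolding subalgebra_def scale_def by (metis mult.right_neutral)
    show "\<phi> f \<in> T"
    proof (induction f rule: free_alg_induct)
      case var_y
      show ?case using c[of 0] assms(2) by simp
    qed (use T c in \<open>simp_all add: alg_endo_const[OF assms(1)] alg_endo_add[OF assms(1)] alg_endo_mult[OF assms(1)] subalgebra_def\<close>)
  qed
  have "subalgebra (range \<phi>)"
    unfolding subalgebra_def
  proof (intro conjI ballI allI)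
    show "1 \<in> range \<phi>" using assms(1) by (metis alg_endo_def rangeI)
    fix f g c assume "f \<in> range \<phi>"
    then obtain p where p: "f = \<phi> p" by blast
    show "scale c f \<in> range \<phi>" using assms(1) p by (metis alg_endo_def rangeI)
    assume "g \<in> range \<phi>"
    then obtain q where q: "g = \<phi> q" by blast
    show "f + g \<in> range \<phi>" "f * g \<in> range \<phi>" using assms(1) p q by (metis alg_endo_def rangeI)+
  qed
  then show "gen_subalgebra (\<phi> var_x) \<subseteq> range \<phi>"
    unfolding gen_subalgebra_def by (intro hull_minimal) auto
qed

section \<open>From the straightened curve to the normal form\<close>

lemma centered_retract_normal_form:
  fixes \<phi> :: "'k::field_char_0 free_alg \<Rightarrow> 'k free_alg"
  assumes \<phi>: "alg_endo \<phi>" and idem: "\<And>p. \<phi> (\<phi> p) = \<phi> p"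
    and centered: "Poly_Mapping.lookup (\<phi> var_x) 0 = 0" "Poly_Mapping.lookup (\<phi> var_y) 0 = 0"
    and proper: "\<phi> \<noteq> id" "\<not> range \<phi> \<subseteq> range const"
  shows "\<exists>\<psi> v q w. alg_auto \<psi> \<and> \<psi> ` range \<phi> = gen_subalgebra v \<and>
    v = var_x + var_y * q + w \<and> w \<in> commutator_ideal"
proof -
  obtain \<theta> where \<theta>: "curve_hom \<theta>" and \<theta>\<phi>: "\<And>p. \<theta> (\<phi> p) = \<theta> p" and ker: "\<And>p. \<theta> p = 0 \<Longrightarrow> \<phi> p = 0"
    using centered_idempotent_cases[OF \<phi> idem centered] proper(1) by blast
  have nc: "degree (\<theta> var_x) > 0 \<or> degree (\<theta> var_y) > 0"
  proof (rule ccontr)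
    assume "\<not> ?thesis"
    then obtain c d where "\<theta> var_x = [:c:]" "\<theta> var_y = [:d:]" by (auto elim!: degree_eq_zeroE)
    then have "\<theta> (var_x - const c) = 0" "\<theta> (var_y - const d) = 0"
      by (simp_all add: curve_hom_diff[OF \<theta>] curve_hom_const[OF \<theta>])
    from this[THEN ker] have xy: "\<phi> var_x = const c" "\<phi> var_y = const d"
      by (simp_all add: alg_endo_diff[OF \<phi>] alg_endo_const[OF \<phi>])
    have "\<phi> f \<in> range const" for f
    proof (induction f rule: free_alg_induct)
      case (add f g)
      then show ?case by (auto simp: alg_endo_add[OF \<phi>] simp flip: const_add)
    next
      case (mult f g)
      then show ?case by (auto simp: alg_endo_mult[OF \<phi>] simp flip: const_mult)
    qed (simp_all add: xy alg_endo_const[OF \<phi>])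
    then show False using proper(2) by blast
  qed
  \<comment> \<open>The equation of the curve is monic over \<open>K[u]\<close> only for nonconstant
    \<open>u = \<theta> var_x\<close>; the constant case is straightened directly.\<close>
  have "\<exists>\<psi>. alg_auto \<psi> \<and> \<theta> (\<psi> var_y) = 0 \<and> degree (\<theta> (\<psi> var_x)) > 0"
  proof (cases "degree (\<theta> var_x) = 0")
    case True
    then show ?thesis using straighten_constant[OF \<theta> nc] by blast
  next
    case False
    then have "smooth_curve \<theta>" using smooth_curve_of_retraction[OF \<theta> _ \<phi> \<theta>\<phi> ker] by simp
    from straighten[OF \<theta> this nc] show ?thesis .
  qed
  then obtain \<psi> where \<psi>: "alg_auto \<psi>" and \<psi>y: "\<theta> (\<psi> var_y) = 0" and \<psi>x: "degree (\<theta> (\<psi> var_x)) > 0" by blast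
  obtain \<psi>' where \<psi>': "alg_auto \<psi>'" "\<And>f. \<psi>' (\<psi> f) = f" "\<And>f. \<psi> (\<psi>' f) = f"
    using alg_auto_inverse[OF \<psi>] by blast
  have endo: "alg_endo \<psi>" "alg_endo \<psi>'" using \<psi> \<psi>'(1) by (auto simp: alg_auto_def)
  define \<phi>' where "\<phi>' = \<psi>' \<circ> \<phi> \<circ> \<psi>"
  have \<phi>': "alg_endo \<phi>'" unfolding \<phi>'_def by (intro alg_endo_comp endo \<phi>)
  have y: "\<phi>' var_y = 0" using ker[OF \<psi>y] by (simp add: \<phi>'_def alg_endo_0[OF endo(2)])
  have "range \<psi> = UNIV" using \<psi>'(3) by (metis surjI)
  moreover have "range \<phi>' = \<psi>' ` \<phi> ` range \<psi>" by (simp add: \<phi>'_def image_comp)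
  ultimately have "\<psi>' ` range \<phi> = range \<phi>'" by simp
  also have "\<dots> = gen_subalgebra (\<phi>' var_x)" by (rule range_eq_gen_subalgebra[OF \<phi>' y])
  finally have range: "\<psi>' ` range \<phi> = gen_subalgebra (\<phi>' var_x)" .
  \<comment> \<open>The second coordinate of the straightened curve is 0, so only the restriction of
    \<open>f\<close> to the axis is seen, composed with a nonconstant polynomial that can be
    cancelled.\<close>
  have \<theta>\<psi>: "\<theta> (\<psi> f) = on_x_axis f \<circ>\<^sub>p \<theta> (\<psi> var_x)" for f
    by (induction f rule: free_alg_induct)
      (simp_all add: alg_endo_const[OF endo(1)] alg_endo_add[OF endo(1)] alg_endo_mult[OF endo(1)]
        curve_hom_const[OF \<theta>] curve_hom_add[OF \<theta>] curve_hom_mult[OF \<theta>] on_x_axis_simps \<psi>y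
        pcompose_add pcompose_mult pcompose_pCons)
  have "\<theta> (\<psi> (\<phi>' var_x)) = \<theta> (\<psi> var_x)" by (simp add: \<phi>'_def \<psi>'(3) \<theta>\<phi>)
  then have "(on_x_axis (\<phi>' var_x) - [:0, 1:]) \<circ>\<^sub>p \<theta> (\<psi> var_x) = 0"
    using \<theta>\<psi>[of "\<phi>' var_x"] by (simp add: pcompose_diff pcompose_pCons)
  then have "on_x_axis (\<phi>' var_x) - [:0, 1:] = 0" using pcompose_eq_0 \<psi>x by blast
  then have "subst var_x 0 (\<phi>' var_x) = subst var_x 0 var_x"
    by (intro subst_x_0_eqI) (simp add: on_x_axis_simps)
  then obtain q w where "\<phi>' var_x = var_x + var_y * q + w" "w \<in> commutator_ideal"
    using eq_modulo_y_and_commutators[of "\<phi>' var_x"] by auto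
  then show ?thesis using range \<psi>'(1) by blast
qed

theorem theorem2p1:
  fixes R :: "'k::field_char_0 free_alg set"
  assumes "proper_retract R"
  shows "\<exists>\<psi> v q w. alg_auto \<psi> \<and> \<psi> ` R = gen_subalgebra v \<and>
           v = var_x + var_y * q + w \<and> w \<in> commutator_ideal"
proof -
  obtain \<phi> where \<phi>: "alg_endo \<phi>" and idem: "\<phi> \<circ> \<phi> = \<phi>" and R: "R = range \<phi>"
    using assms by (auto simp: proper_retract_def retract_def)
  have idem': "\<phi> (\<phi> p) = \<phi> p" for p using fun_cong[OF idem, of p] by simp
  \<comment> \<open>The constant terms give a point \<open>(\<alpha>, \<beta>)\<close> that is fixed
    by the map defined by \<phi>, because \<phi> is idempotent. Moving it to the origin centers the
    retraction.\<close>
  define \<alpha> where "\<alpha> = Poly_Mapping.lookup (\<phi> var_x) 0"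
  define \<beta> where "\<beta> = Poly_Mapping.lookup (\<phi> var_y) 0"
  define \<tau> where "\<tau> = subst (var_x + const \<alpha>) (var_y + const \<beta>)"
  have \<tau>: "alg_auto \<tau>" unfolding \<tau>_def by (rule alg_auto_translation)
  then have \<tau>e: "alg_endo \<tau>" by (simp add: alg_auto_def)
  obtain \<tau>' where \<tau>': "alg_auto \<tau>'" "\<And>f. \<tau>' (\<tau> f) = f" "\<And>f. \<tau> (\<tau>' f) = f"
    using alg_auto_inverse[OF \<tau>] by blast
  have \<tau>'e: "alg_endo \<tau>'" using \<tau>'(1) by (simp add: alg_auto_def)
  have "\<tau>' var_x = var_x - const \<alpha>" "\<tau>' var_y = var_y - const \<beta>"
    using \<tau>'(2)[of "var_x - const \<alpha>"] \<tau>'(2)[of "var_y - const \<beta>"]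
    by (simp_all add: \<tau>_def alg_endo_diff[OF alg_endo_subst])
  note \<tau>'xy = this
  \<comment> \<open>Both sides evaluate \<open>f\<close> at the point
    \<open>(\<alpha>, \<beta>)\<close>.\<close>
  have lookup_\<tau>: "Poly_Mapping.lookup (\<tau> f) 0 = Poly_Mapping.lookup (\<phi> f) 0" for f
  proof (induction f rule: free_alg_induct)
    case var_x
    then show ?case by (simp add: \<tau>_def \<alpha>_def lookup_add lookup_const)
      (simp add: var_x_def lookup_single zero_word_def)
  next
    case var_y
    then show ?case by (simp add: \<tau>_def \<beta>_def lookup_add lookup_const)
      (simp add: var_y_def lookup_single zero_word_def)
  qed (simp_all add: alg_endo_const[OF \<phi>] alg_endo_const[OF \<tau>e] alg_endo_add[OF \<phi>] alg_endo_add[OF \<tau>e]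
      alg_endo_mult[OF \<phi>] alg_endo_mult[OF \<tau>e] lookup_add lookup_0_mult)
  define \<phi>' where "\<phi>' = \<tau> \<circ> \<phi> \<circ> \<tau>'"
  have \<phi>': "alg_endo \<phi>'" unfolding \<phi>'_def by (intro alg_endo_comp \<tau>e \<tau>'e \<phi>)
  have \<tau>'surj: "range \<tau>' = UNIV" using \<tau>'(2) by (metis surjI)
  have "range \<phi>' = \<tau> ` \<phi> ` range \<tau>'" by (simp add: \<phi>'_def image_comp)
  then have range: "range \<phi>' = \<tau> ` R" using \<tau>'surj by (simp add: R)
  have "\<exists>\<psi> v q w. alg_auto \<psi> \<and> \<psi> ` range \<phi>' = gen_subalgebra v \<and>
    v = var_x + var_y * q + w \<and> w \<in> commutator_ideal"
  proof (rule centered_retract_normal_form[OF \<phi>'])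
    show "\<phi>' (\<phi>' p) = \<phi>' p" for p by (simp add: \<phi>'_def \<tau>'(2) idem')
    show "Poly_Mapping.lookup (\<phi>' var_x) 0 = 0"
      by (simp add: \<phi>'_def \<tau>'xy alg_endo_diff[OF \<phi>] alg_endo_diff[OF \<tau>e] alg_endo_const[OF \<phi>]
          alg_endo_const[OF \<tau>e] lookup_minus lookup_const lookup_\<tau> idem') (simp add: \<alpha>_def)
    show "Poly_Mapping.lookup (\<phi>' var_y) 0 = 0"
      by (simp add: \<phi>'_def \<tau>'xy alg_endo_diff[OF \<phi>] alg_endo_diff[OF \<tau>e] alg_endo_const[OF \<phi>]
          alg_endo_const[OF \<tau>e] lookup_minus lookup_const lookup_\<tau> idem') (simp add: \<beta>_def)
    have R': "R = \<tau>' ` range \<phi>'" by (simp add: range image_comp o_def \<tau>'(2))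
    show "\<phi>' \<noteq> id"
    proof
      assume "\<phi>' = id"
      then have "R = UNIV" using R' \<tau>'surj by simp
      then show False using assms by (simp add: proper_retract_def)
    qed
    show "\<not> range \<phi>' \<subseteq> range const"
    proof
      assume "range \<phi>' \<subseteq> range const"
      then have "\<tau>' ` range \<phi>' \<subseteq> \<tau>' ` range const" by (rule image_mono)
      then have "R \<subseteq> range const" using R' by (simp add: image_comp o_def alg_endo_const[OF \<tau>'e])
      moreover have "const c \<in> R" for c
        unfolding R using rangeI[of \<phi> "const c"] by (simp only: alg_endo_const[OF \<phi>])
      then have "range const \<subseteq> R" by blast
      ultimately show False using assms by (auto simp: proper_retract_def)
    qed
  qed
  then obtain \<psi> v q w where *: "alg_auto \<psi>" "\<psi> ` \<tau> ` R = gen_subalgebra v"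
    "v = var_x + var_y * q + w" "w \<in> commutator_ideal" unfolding range by blast
  then have "alg_auto (\<psi> \<circ> \<tau>)" "(\<psi> \<circ> \<tau>) ` R = gen_subalgebra v"
    using alg_auto_comp[OF _ \<tau>] by (auto simp: image_comp)
  then show ?thesis using *(3,4) by blast
qed

end
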